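(* Let $a(n)$ denote the number of non-isomorphic abelian groups with $n$ elements, and let $Q(x) := \sum_{n\le x} a(n+a(n))$. There is a constant $C>0$ such that for every $\varepsilon>0$ the asymptotic formula $$Q(x) = Cx + O\left(x^{3/4+\varepsilon}\right)$$ holds, where the $O$-constant depends only on $\varepsilon$.
   Context: The function $a(n)$ is multiplicative, and $a(p^{\alpha}) = P(\alpha)$ for every prime $p$ and integer $\alpha\ge 1$, where $P(\alpha)$ is the number of partitions of $\alpha$. The sum over $n\le x$ runs over positive integers $n$. The constant $C$ is independent of $x$ and of $\varepsilon$. Here $\varepsilon$ denotes a small enough positive constant, and $x$ is a large real parameter. *)

theory Defs
  imports Complex_Main "HOL-Algebra.Coset" "HOL-Library.Landau_Symbols"
begin

text \<open>
  Isomorphism classes of abelian groups are formed over the fixed type \<^typ>\<open>nat\<close>, since a set of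
  all groups over all types is not available. The lemma \<open>abelian_group_representative\<close> below shows
  that this misses no finite abelian group. The finiteness condition excludes infinite groups, whose
  \<^const>\<open>order\<close> is \<open>0\<close>.
\<close>

definition abelian_groups_of_order :: "nat \<Rightarrow> nat monoid set" where
  "abelian_groups_of_order n = {G. comm_group G \<and> finite (carrier G) \<and> order G = n}"

definition abelian_iso_rel :: "nat \<Rightarrow> (nat monoid \<times> nat monoid) set" where
  "abelian_iso_rel n =
     {(G, H). G \<in> abelian_groups_of_order n \<and> H \<in> abelian_groups_of_order n \<and> G \<cong> H}"

definition num_abelian_groups :: "nat \<Rightarrow> nat" where
  "num_abelian_groups n = card (abelian_groups_of_order n // abelian_iso_rel n)"

definition Q :: "real \<Rightarrow> real" where
  "Q x = (\<Sum>n | 1 \<le> n \<and> real n \<le> x. real (num_abelian_groups (n + num_abelian_groups n)))"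

lemma equiv_abelian_iso_rel: "equiv (abelian_groups_of_order n) (abelian_iso_rel n)"
proof (rule equivI)
  show "abelian_iso_rel n \<subseteq> abelian_groups_of_order n \<times> abelian_groups_of_order n"
    by (auto simp: abelian_iso_rel_def)
  show "refl_on (abelian_groups_of_order n) (abelian_iso_rel n)"
    by (auto simp: refl_on_def abelian_iso_rel_def)
  show "sym (abelian_iso_rel n)"
    by (auto simp: sym_def abelian_iso_rel_def abelian_groups_of_order_def comm_group_def
        intro: group.iso_sym)
  show "trans (abelian_iso_rel n)"
    by (auto simp: trans_def abelian_iso_rel_def intro: iso_trans)
qed

text \<open>
  Every finite abelian group over any type is isomorphic to one given by a multiplication table on
  \<open>{..<n}\<close>. The table is fixed to \<open>undefined\<close> outside the carrier, so that there are only finitely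
  many of them.
\<close>

lemma abelian_group_representative:
  fixes G :: "('a, 'b) monoid_scheme"
  assumes "comm_group G" "finite (carrier G)"
  obtains H :: "nat monoid" where
    "H \<in> abelian_groups_of_order (order G)" "G \<cong> H" "carrier H = {..<order G}"
    "case_prod (mult H) \<in> ({..<order G} \<times> {..<order G}) \<rightarrow>\<^sub>E {..<order G}"
proof -
  interpret comm_group G by fact
  obtain h where h: "bij_betw h (carrier G) {..<order G}"
    using ex_bij_betw_finite_nat[OF assms(2)] by (auto simp: order_def lessThan_atLeast0)
  define g where "g = inv_into (carrier G) h"
  have hC: "h x \<in> {..<order G}" if "x \<in> carrier G" for x
    using h that by (auto simp: bij_betw_def)
  have gh: "g (h x) = x" if "x \<in> carrier G" for x
    using h that by (simp add: g_def bij_betw_inv_into_left)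
  have gC: "g i \<in> carrier G" if "i \<in> {..<order G}" for i
    using h that by (metis bij_betw_def g_def inv_into_into)
  define H :: "nat monoid" where
    "H = \<lparr>carrier = {..<order G},
          mult = (\<lambda>i j. if i < order G \<and> j < order G then h (g i \<otimes>\<^bsub>G\<^esub> g j) else undefined),
          one = h \<one>\<^bsub>G\<^esub>\<rparr>"
  have car: "carrier H = {..<order G}" by (simp add: H_def)
  have tab: "case_prod (mult H) \<in> ({..<order G} \<times> {..<order G}) \<rightarrow>\<^sub>E {..<order G}"
  proof (rule PiE_I)
    fix z assume "z \<in> {..<order G} \<times> {..<order G}"
    then obtain i j where z: "z = (i, j)" "i < order G" "j < order G" by auto
    then show "case_prod (mult H) z \<in> {..<order G}"
      using hC[OF m_closed[OF gC gC], of i j] by (simp add: H_def)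
  qed (auto simp: H_def split: if_splits)
  have hom: "h \<in> hom G H"
    unfolding hom_def using hC gh by (auto simp: H_def)
  then have iso: "h \<in> iso G H"
    using h by (simp add: iso_def car)
  have "comm_group (H\<lparr>one := h \<one>\<^bsub>G\<^esub>\<rparr>)"
    using iso by (rule iso_imp_img_comm_group)
  then have "comm_group H" by (simp add: H_def)
  then have "H \<in> abelian_groups_of_order (order G)"
    by (simp add: abelian_groups_of_order_def car order_def)
  moreover have "G \<cong> H" using iso by (rule is_isoI)
  ultimately show ?thesis using that car tab by blast
qed

lemma finite_abelian_iso_classes: "finite (abelian_groups_of_order n // abelian_iso_rel n)"
proof -
  define F where "F = ({..<n} \<times> {..<n}) \<rightarrow>\<^sub>E {..<n}"
  define mk :: "((nat \<times> nat) \<Rightarrow> nat) \<times> nat \<Rightarrow> nat monoid" where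
    "mk = (\<lambda>(m, e). \<lparr>carrier = {..<n}, mult = curry m, one = e\<rparr>)"
  have fin: "finite (mk ` (F \<times> {..<n}))"
    by (auto simp: F_def intro!: finite_PiE)
  have "abelian_groups_of_order n // abelian_iso_rel n
          \<subseteq> (\<lambda>H. abelian_iso_rel n `` {H}) ` (mk ` (F \<times> {..<n}))"
  proof
    fix X assume "X \<in> abelian_groups_of_order n // abelian_iso_rel n"
    then obtain G where G: "G \<in> abelian_groups_of_order n" and X: "X = abelian_iso_rel n `` {G}"
      by (auto elim: quotientE)
    then have ord: "order G = n" and fG: "comm_group G" "finite (carrier G)"
      by (auto simp: abelian_groups_of_order_def)
    obtain H :: "nat monoid" where H: "H \<in> abelian_groups_of_order n" "G \<cong> H"
      "carrier H = {..<n}" "case_prod (mult H) \<in> F"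
      by (rule abelian_group_representative[OF fG]) (auto simp: ord F_def)
    have "(G, H) \<in> abelian_iso_rel n" using G H by (simp add: abelian_iso_rel_def)
    then have XH: "X = abelian_iso_rel n `` {H}"
      unfolding X by (rule equiv_class_eq[OF equiv_abelian_iso_rel])
    have "\<one>\<^bsub>H\<^esub> \<in> carrier H"
      using H(1) by (auto simp: abelian_groups_of_order_def comm_group_def group_def
          intro: monoid.one_closed)
    moreover have "H = mk (case_prod (mult H), \<one>\<^bsub>H\<^esub>)"
      using H(3) by (simp add: mk_def)
    ultimately have "H \<in> mk ` (F \<times> {..<n})"
      using H(3,4) by (metis SigmaI image_eqI)
    then show "X \<in> (\<lambda>H. abelian_iso_rel n `` {H}) ` (mk ` (F \<times> {..<n}))"
      using XH by blast
  qed
  then show ?thesis using fin by (meson finite_imageI finite_subset)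
qed

end

theory Submission
  imports Defs "HOL-Algebra.Elementary_Groups" "HOL-Algebra.Multiplicative_Group" "HOL-Algebra.Sylow"
    "HOL-Computational_Algebra.Squarefree" "HOL-Analysis.Infinite_Sum" "HOL-Analysis.Summation_Tests"
begin

text \<open>
  Write \<open>a n\<close> for the number of isomorphism classes of abelian groups of order \<open>n\<close>. Three properties of
  \<open>a\<close> are all that the asymptotic formula needs: \<open>a n \<ge> 1\<close>, the equation \<open>a (p m) = a m\<close> for a prime
  \<open>p\<close> not dividing \<open>m\<close>, and \<open>a n \<le> K n\<^sup>\<epsilon>\<close> for every \<open>\<epsilon> > 0\<close>. They are proved from the groups themselves.
  Splitting a finite abelian group into its \<open>n\<close>-torsion and its \<open>m\<close>-torsion, for coprime \<open>n\<close> and \<open>m\<close>,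
  makes \<open>a\<close> multiplicative (\<open>num_abelian_groups_mult\<close>). In an abelian \<open>p\<close>-group a cyclic
  subgroup of maximal order is a direct factor (\<open>cyclic_complement\<close>). Hence the number \<open>N(k, j)\<close> of
  classes of order \<open>p\<^sup>k\<close> and exponent dividing \<open>p\<^sup>j\<close> satisfies
  \<open>N(k, j + 1) \<le> N(k, j) + N(k - j - 1, j + 1)\<close>, the recursion of the partition function, and therefore is
  bounded by the coefficients of Euler's product. Uniqueness of the decomposition into
  cyclic groups is not needed.

  For the sum, Moebius inversion in the argument of \<open>h \<mapsto> a (n + a h)\<close> and then of \<open>a\<close> itself gives
  \<open>a (n + a n) = (\<Sum>e | e dvd n. \<Sum>h | h dvd e. \<mu> (e div h) * (\<Sum>d | d dvd n + a h. b d))\<close>,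
  where \<open>b = \<mu> * a\<close>. Since \<open>a\<close> ignores primes that divide its argument exactly once, only squarefull
  \<open>e\<close> and \<open>d\<close> contribute (\<open>moebius_transform_not_squarefull\<close>). For fixed \<open>e, d, h\<close> the
  conditions \<open>e dvd n\<close> and \<open>d dvd n + a h\<close> are either contradictory or define one residue class modulo
  \<open>lcm e d\<close>, so that the number of \<open>n \<le> N\<close> satisfying them is \<open>N\<close> times a density, with an error at
  most \<open>1\<close> (\<open>count_approx_density\<close>). The constant of the theorem is the absolutely convergent sum of all
  densities with their weights.

  The squarefull numbers have \<open>\<Sum> e powr (- 1/2 - \<delta>) < \<infinity>\<close>, because they are of the form \<open>x\<^sup>2 y\<^sup>3\<close>.
  Cut both \<open>e\<close> and \<open>d\<close> at \<open>D = sqrt N\<close>. There are \<open>O(D powr (1 + 2 \<delta>))\<close> small pairs, and they cost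
  \<open>N powr (1/2 + \<dots>)\<close>. The pairs with \<open>e > D\<close> or \<open>d > D\<close> cost
  \<open>N powr (1 + \<dots>) * (\<Sum>e > D. 1 / e) = N powr (1 + \<dots>) * D powr (- 1/2 + \<dots>)\<close>, which is
  \<open>N powr (3/4 + \<dots>)\<close>. The tail of the constant, multiplied by \<open>N\<close>, has the same size.
\<close>

section \<open>Cyclic direct factors of abelian p-groups\<close>

lemma (in group) int_pow_mem_of_coprime:
  assumes L: "subgroup L G" and g: "g \<in> carrier G" and m: "g [^] (m::int) \<in> L" and n: "g [^] (n::int) \<in> L"
    and "coprime m n"
  shows "g \<in> L"
proof -
  obtain u v where uv: "u * m + v * n = 1"
    using \<open>coprime m n\<close> bezout_int[of m n] by auto
  have "g = g [^] (m * u + n * v)" using uv g by (simp add: mult.commute[of m] mult.commute[of n])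
  also have "\<dots> = (g [^] m) [^] u \<otimes> (g [^] n) [^] v"
    using g by (simp add: int_pow_mult int_pow_pow)
  also have "\<dots> \<in> L"
    by (intro subgroup.m_closed[OF L] subgroup_int_pow_closed[OF L m] subgroup_int_pow_closed[OF L n])
  finally show ?thesis .
qed

lemma (in comm_group) subgroup_adjoin:
  assumes K: "subgroup K G" and g: "g \<in> carrier G"
  shows "subgroup {k \<otimes> g [^] (s::int) | k s. k \<in> K} G" (is "subgroup ?L G")
proof (rule subgroupI)
  have KG: "K \<subseteq> carrier G" using K by (rule subgroup.subset)
  show "?L \<subseteq> carrier G" using KG g by auto
  show "?L \<noteq> {}" using subgroup.one_closed[OF K] by blast
  fix a assume "a \<in> ?L"
  then obtain k s where a: "a = k \<otimes> g [^] (s::int)" "k \<in> K" by blast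
  have "inv a = inv k \<otimes> g [^] (- s)"
    using a KG g by (auto simp: inv_mult int_pow_neg)
  then show "inv a \<in> ?L" using subgroup.m_inv_closed[OF K a(2)] by blast
  fix b assume "b \<in> ?L"
  then obtain l t where b: "b = l \<otimes> g [^] (t::int)" "l \<in> K" by blast
  have "a \<otimes> b = (k \<otimes> l) \<otimes> g [^] (s + t)"
    using a b KG g by (auto simp: int_pow_mult subset_iff m_ac)
  then show "a \<otimes> b \<in> ?L" using subgroup.m_closed[OF K a(2) b(2)] by blast
qed

text \<open>
  The complement is a subgroup \<open>K\<close> that is maximal among those meeting \<open>\<langle>x\<rangle>\<close> trivially. If
  \<open>\<langle>x\<rangle> K\<close> were not the whole group, some \<open>h\<close> outside it would have its \<open>p\<close>-th power inside, and because
  \<open>x\<close> has the largest possible order, \<open>h\<close> could be shifted by a power of \<open>x\<close> so that this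
  \<open>p\<close>-th power lies in \<open>K\<close>. Adjoining the shifted element to \<open>K\<close> would contradict maximality.
\<close>

lemma (in comm_group) cyclic_complement:
  assumes fin: "finite (carrier G)" and x: "x \<in> carrier G" and p: "prime (p::nat)"
    and ox: "ord x = p ^ Suc j" and ex: "\<And>g. g \<in> carrier G \<Longrightarrow> g [^] (p ^ Suc j) = \<one>"
  obtains K where "subgroup K G" "range (\<lambda>n::int. x [^] n) \<inter> K = {\<one>}"
    "range (\<lambda>n::int. x [^] n) <#> K = carrier G"
proof -
  define C where "C = range (\<lambda>n::int. x [^] n)"
  have C: "subgroup C G" unfolding C_def using x by (rule subgroup_of_powers)
  have CG: "C \<subseteq> carrier G" using C by (rule subgroup.subset)
  define \<K> where "\<K> = {K. subgroup K G \<and> C \<inter> K = {\<one>}}"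
  have "\<K> \<subseteq> Pow (carrier G)" by (auto simp: \<K>_def dest: subgroup.subset)
  then have fK: "finite \<K>" using fin by (meson finite_Pow_iff finite_subset)
  have "{\<one>} \<in> \<K>" using subgroup.one_closed[OF C] by (auto simp: \<K>_def triv_subgroup)
  then have "\<exists>K\<in>\<K>. \<forall>K'\<in>\<K>. K \<subseteq> K' \<longrightarrow> K = K'"
    using finite_has_maximal[OF fK] by blast
  then obtain K where K: "subgroup K G" and CK: "C \<inter> K = {\<one>}"
    and max: "\<And>K'. subgroup K' G \<Longrightarrow> C \<inter> K' = {\<one>} \<Longrightarrow> K \<subseteq> K' \<Longrightarrow> K = K'"
    by (auto simp: \<K>_def)
  have KG: "K \<subseteq> carrier G" using K by (rule subgroup.subset)
  define L where "L = {k \<otimes> x [^] (s::int) | k s. k \<in> K}"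
  have L: "subgroup L G" unfolding L_def by (rule subgroup_adjoin[OF K x])
  have KL: "K \<subseteq> L" 
  proof
    fix k assume "k \<in> K"
    moreover have "k = k \<otimes> x [^] (0::int)" using \<open>k \<in> K\<close> KG by auto
    ultimately show "k \<in> L" unfolding L_def by blast
  qed
  have "g \<in> L" if g: "g \<in> carrier G" for g
  proof (rule ccontr)
    assume "g \<notin> L"
    have "g [^] (p ^ Suc j) \<in> L" using ex[OF g] subgroup.one_closed[OF L] by simp
    then have exi: "\<exists>i. g [^] (p ^ i) \<in> L" by blast
    define i where "i = (LEAST i. g [^] (p ^ i) \<in> L)"
    have i: "g [^] (p ^ i) \<in> L" unfolding i_def using exi by (rule LeastI_ex)
    have "i \<noteq> 0" using i \<open>g \<notin> L\<close> g by (cases "i = 0") auto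
    then obtain i' where i': "i = Suc i'" by (cases i) auto
    define h where "h = g [^] (p ^ i')"
    have hG: "h \<in> carrier G" using g by (simp add: h_def)
    have hL: "h \<notin> L" unfolding h_def using not_less_Least[of i' "\<lambda>i. g [^] (p ^ i) \<in> L"] i' i_def by simp
    have "h [^] p \<in> L" using i g by (simp add: h_def i' nat_pow_pow mult.commute)
    then obtain k a where k: "k \<in> K" and hp: "h [^] p = k \<otimes> x [^] (a::int)"
      unfolding L_def by blast
    have kG: "k \<in> carrier G" using k KG by auto
    \<comment> \<open>The exponent bound, applied to \<open>h\<close>, shows that the exponent \<open>a\<close> of \<open>x\<close> is divisible by \<open>p\<close>.\<close>
    have "\<one> = (h [^] p) [^] (p ^ j)"
      using ex[OF hG] hG by (simp add: nat_pow_pow)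
    also have "\<dots> = k [^] (p ^ j) \<otimes> x [^] (a * int (p ^ j))"
      using kG x int_pow_pow[OF x, of a "int (p ^ j)"]
      unfolding hp by (simp add: nat_pow_distrib int_pow_int del: of_nat_power)
    finally have 1: "k [^] (p ^ j) \<otimes> x [^] (a * int (p ^ j)) = \<one>" by simp
    then have "inv (k [^] (p ^ j)) = x [^] (a * int (p ^ j))"
      using kG x by (metis int_pow_closed inv_equality m_comm nat_pow_closed)
    moreover have "k [^] (p ^ j) \<in> K"
      using subgroup_int_pow_closed[OF K k, of "int (p^j)"] by (simp only: int_pow_int)
    ultimately have "x [^] (a * int (p ^ j)) \<in> K"
      using subgroup.m_inv_closed[OF K] by metis
    then have "x [^] (a * int (p ^ j)) \<in> C \<inter> K" unfolding C_def by blast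
    then have "int (ord x) dvd a * int (p ^ j)"
      using CK x int_pow_eq_id by auto
    then have "int p dvd a" using p by (simp add: ox prime_gt_0_nat)
    then obtain a' where a': "a = int p * a'" by auto
    \<comment> \<open>Shifting \<open>h\<close> by this power of \<open>x\<close> removes the \<open>\<langle>x\<rangle>\<close>-part of its \<open>p\<close>-th power.\<close>
    define g' where "g' = h \<otimes> x [^] (- a')"
    have g'G: "g' \<in> carrier G" using hG x by (simp add: g'_def)
    have "g' [^] int p = h [^] int p \<otimes> (x [^] (- a')) [^] int p"
      unfolding g'_def using hG x by (intro int_pow_distrib) auto
    also have "\<dots> = h [^] p \<otimes> x [^] (- a)"
      using x int_pow_pow[of x "- a'" "int p"] by (simp add: int_pow_int a' mult.commute)
    also have "\<dots> = k \<otimes> (x [^] a \<otimes> x [^] (- a))" using hp kG x by (simp add: m_assoc)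
    also have "\<dots> = k" using kG x by (simp flip: int_pow_mult)
    finally have g'p: "g' [^] int p = k" .
    have xL: "x [^] b \<in> L" for b :: int
    proof -
      have "x [^] b = \<one> \<otimes> x [^] b" using x by simp
      then show ?thesis unfolding L_def using subgroup.one_closed[OF K] by blast
    qed
    have g'L: "g' \<notin> L"
    proof
      assume "g' \<in> L"
      then have "g' \<otimes> x [^] a' \<in> L" using xL by (intro subgroup.m_closed[OF L])
      moreover have "g' \<otimes> x [^] a' = h" using hG x by (simp add: g'_def m_assoc flip: int_pow_mult)
      ultimately show False using hL by simp
    qed
    define K' where "K' = {k \<otimes> g' [^] (s::int) | k s. k \<in> K}"
    have K': "subgroup K' G" unfolding K'_def by (rule subgroup_adjoin[OF K g'G])
    have KK': "K \<subseteq> K'"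
    proof
      fix k assume "k \<in> K"
      moreover have "k = k \<otimes> g' [^] (0::int)" using \<open>k \<in> K\<close> KG by auto
      ultimately show "k \<in> K'" unfolding K'_def by blast
    qed
    have "g' = \<one> \<otimes> g' [^] (1::int)" using g'G by simp
    then have "g' \<in> K'" unfolding K'_def using subgroup.one_closed[OF K] by blast
    moreover have "g' \<notin> K" using g'L KL by auto
    ultimately have "C \<inter> K' \<noteq> {\<one>}" using max[OF K'] KK' by auto
    moreover have "\<one> \<in> C \<inter> K'" using subgroup.one_closed C K' by blast
    ultimately obtain y where y: "y \<in> C" "y \<in> K'" "y \<noteq> \<one>" by blast
    then obtain k2 s where k2: "k2 \<in> K" "y = k2 \<otimes> g' [^] (s::int)" unfolding K'_def by blast
    have k2G: "k2 \<in> carrier G" using k2 KG by auto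
    show False
    proof (cases "int p dvd s")
      case True
      then obtain t where "s = int p * t" by auto
      then have "g' [^] s = k [^] t" using g'p g'G by (metis int_pow_pow)
      then have "y \<in> K" using k2 subgroup.m_closed[OF K] subgroup_int_pow_closed[OF K k] by auto
      then show False using y CK by auto
    next
      case False
      then have "coprime (int p) s" using p by (simp add: prime_imp_coprime)
      moreover have "g' [^] s = inv k2 \<otimes> y" using k2 k2G g'G by (simp add: inv_solve_left)
      moreover have "y \<in> L" using y(1) xL by (auto simp: C_def)
      ultimately have "g' [^] s \<in> L"
        using k2 KL subgroup.m_closed[OF L] subgroup.m_inv_closed[OF L] by (metis subsetD)
      moreover have "g' [^] int p \<in> L" using g'p k KL by auto
      ultimately have "g' \<in> L"
        using int_pow_mem_of_coprime[OF L g'G] \<open>coprime (int p) s\<close> by blast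
      then show False using g'L by simp
    qed
  qed
  have "C <#> K = carrier G"
  proof
    show "C <#> K \<subseteq> carrier G" using CG KG by (auto simp: set_mult_def)
    show "carrier G \<subseteq> C <#> K"
    proof
      fix g assume g: "g \<in> carrier G"
      then obtain k s where "k \<in> K" "g = k \<otimes> x [^] (s::int)" using \<open>\<And>g. g \<in> carrier G \<Longrightarrow> g \<in> L\<close> unfolding L_def by blast
      then have "g = x [^] s \<otimes> k" using KG x m_comm by auto
      then show "g \<in> C <#> K" using \<open>k \<in> K\<close> unfolding set_mult_def C_def by blast
    qed
  qed
  with that[OF K] CK show ?thesis unfolding C_def by blast
qed

lemma (in group) powers_iso_integer_mod:
  assumes x: "x \<in> carrier G" and o: "ord x = n" "n > 0"
  shows "integer_mod_group n \<cong> subgroup_generated G (range (\<lambda>i::int. x [^] i))"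
proof -
  let ?C = "range (\<lambda>i::int. x [^] i)"
  have C: "subgroup ?C G" using x by (rule subgroup_of_powers)
  have md: "x [^] (i mod int n) = x [^] i" for i :: int
    using x o by (simp add: int_pow_eq mod_eq_dvd_iff[symmetric])
  have "(\<lambda>i::int. x [^] i) \<in> iso (integer_mod_group n) (subgroup_generated G ?C)"
    unfolding iso_iff
  proof (intro conjI)
    show "(\<lambda>i::int. x [^] i) \<in> hom (integer_mod_group n) (subgroup_generated G ?C)"
      using C x md by (auto simp: hom_def subgroup.carrier_subgroup_generated_subgroup int_pow_mult)
    have "?C \<subseteq> (\<lambda>i::int. x [^] i) ` carrier (integer_mod_group n)"
    proof
      fix y assume "y \<in> ?C"
      then obtain i :: int where "y = x [^] (i mod int n)" using md by auto
      then show "y \<in> (\<lambda>i::int. x [^] i) ` carrier (integer_mod_group n)"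
        using o by (auto simp: carrier_integer_mod_group)
    qed
    then show "(\<lambda>i::int. x [^] i) ` carrier (integer_mod_group n) = carrier (subgroup_generated G ?C)"
      using C by (auto simp: subgroup.carrier_subgroup_generated_subgroup)
    show "inj_on (\<lambda>i::int. x [^] i) (carrier (integer_mod_group n))"
    proof (rule inj_onI)
      fix i k assume A: "i \<in> carrier (integer_mod_group n)" "k \<in> carrier (integer_mod_group n)" "x [^] i = x [^] k"
      then have "k mod int n = i mod int n" using x o by (simp add: int_pow_eq mod_eq_dvd_iff)
      then show "i = k" using A(1,2) o by (auto simp: carrier_integer_mod_group)
    qed
  qed
  then show ?thesis by (rule is_isoI)
qed

section \<open>Isomorphism classes and torsion subgroups\<close>

text \<open>
  The abelian groups on natural numbers isomorphic to \<open>G\<close>, where \<open>G\<close> itself may live on any type.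
  For finite abelian groups, equality of these sets is isomorphism, so isomorphism
  classes can be counted as images of \<open>iso_class\<close>.
\<close>

definition iso_class :: "('a, 'b) monoid_scheme \<Rightarrow> nat monoid set" where
  "iso_class G = {H. comm_group H \<and> G \<cong> H}"

lemma iso_class_eq_iff:
  fixes G :: "('a, 'b) monoid_scheme" and G' :: "('c, 'd) monoid_scheme"
  assumes "comm_group G" "finite (carrier G)" "comm_group G'"
  shows "iso_class G = iso_class G' \<longleftrightarrow> G \<cong> G'"
proof
  assume eq: "iso_class G = iso_class G'"
  obtain H :: "nat monoid" where H: "H \<in> abelian_groups_of_order (order G)" "G \<cong> H"
    using abelian_group_representative[OF assms(1,2)] by metis
  then have "H \<in> iso_class G" by (simp add: iso_class_def abelian_groups_of_order_def)
  then have "H \<in> iso_class G'" using eq by simp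
  then have "G' \<cong> H" by (simp add: iso_class_def)
  then show "G \<cong> G'"
    using H(2) assms(3) by (meson comm_group_def group.iso_sym iso_trans)
next
  assume "G \<cong> G'"
  moreover from this have "G' \<cong> G" using assms(1) by (meson comm_group_def group.iso_sym)
  ultimately show "iso_class G = iso_class G'"
    by (auto simp: iso_class_def intro: iso_trans)
qed

lemma num_abelian_groups_altdef:
  "num_abelian_groups n = card (iso_class ` abelian_groups_of_order n)"
proof -
  let ?A = "abelian_groups_of_order n"
  have inj: "iso_class G = iso_class H \<longleftrightarrow> (G, H) \<in> abelian_iso_rel n" if "G \<in> ?A" "H \<in> ?A" for G H
    using that iso_class_eq_iff[of G H] by (auto simp: abelian_iso_rel_def abelian_groups_of_order_def)
  have "bij_betw (\<lambda>X. \<Union>(iso_class ` X)) (?A // abelian_iso_rel n) (iso_class ` ?A)"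
    unfolding bij_betw_def
  proof
    have *: "\<Union> (iso_class ` (abelian_iso_rel n `` {G})) = iso_class G" if "G \<in> ?A" for G
    proof -
      have "iso_class H = iso_class G" if "H \<in> abelian_iso_rel n `` {G}" for H
        using inj[of G H] that \<open>G \<in> ?A\<close> by (auto simp: abelian_iso_rel_def)
      moreover have "G \<in> abelian_iso_rel n `` {G}"
        using that equiv_class_self[OF equiv_abelian_iso_rel] by blast
      ultimately show ?thesis by blast
    qed
    show "inj_on (\<lambda>X. \<Union>(iso_class ` X)) (?A // abelian_iso_rel n)"
    proof (rule inj_onI)
      fix X Y assume "X \<in> ?A // abelian_iso_rel n" "Y \<in> ?A // abelian_iso_rel n"
        and eq: "\<Union>(iso_class ` X) = \<Union>(iso_class ` Y)"
      then obtain G H where G: "G \<in> ?A" "X = abelian_iso_rel n `` {G}" "H \<in> ?A" "Y = abelian_iso_rel n `` {H}"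
        by (auto elim!: quotientE)
      then have "(G, H) \<in> abelian_iso_rel n" using eq * inj by auto
      then show "X = Y" using G equiv_class_eq[OF equiv_abelian_iso_rel] by metis
    qed
    show "(\<lambda>X. \<Union> (iso_class ` X)) ` (?A // abelian_iso_rel n) = iso_class ` ?A"
      using * by (auto simp: quotient_def image_iff)
  qed
  then show ?thesis unfolding num_abelian_groups_def by (rule bij_betw_same_card)
qed

lemma finite_iso_class_image: "finite (iso_class ` abelian_groups_of_order n)"
proof -
  have "iso_class ` abelian_groups_of_order n \<subseteq> (\<lambda>X. \<Union>(iso_class ` X)) ` (abelian_groups_of_order n // abelian_iso_rel n)"
  proof
    fix c assume "c \<in> iso_class ` abelian_groups_of_order n"
    then obtain G where G: "G \<in> abelian_groups_of_order n" "c = iso_class G" by auto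
    have "iso_class H = iso_class G" if "H \<in> abelian_iso_rel n `` {G}" for H
      using that G iso_class_eq_iff[of G H] by (auto simp: abelian_iso_rel_def abelian_groups_of_order_def)
    moreover have "G \<in> abelian_iso_rel n `` {G}"
      using G equiv_abelian_iso_rel by (meson equiv_class_self)
    ultimately have "c = \<Union>(iso_class ` (abelian_iso_rel n `` {G}))" using G by blast
    then show "c \<in> (\<lambda>X. \<Union>(iso_class ` X)) ` (abelian_groups_of_order n // abelian_iso_rel n)"
      using G by (auto simp: quotientI)
  qed
  then show ?thesis using finite_abelian_iso_classes by (meson finite_imageI finite_subset)
qed

lemma iso_class_in_image:
  fixes G :: "('a, 'b) monoid_scheme"
  assumes "comm_group G" "finite (carrier G)" "order G = n"
  shows "iso_class G \<in> iso_class ` abelian_groups_of_order n"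
proof -
  obtain H :: "nat monoid" where H: "H \<in> abelian_groups_of_order (order G)" "G \<cong> H"
    using abelian_group_representative[OF assms(1,2)] by metis
  moreover have "iso_class G = iso_class H"
    using H assms iso_class_eq_iff[of G H] by (auto simp: abelian_groups_of_order_def)
  ultimately show ?thesis using assms(3) by auto
qed

text \<open>
  The counting principle for isomorphism classes: if \<open>f\<close> determines \<open>g\<close> on \<open>A\<close>, then \<open>g\<close> takes at most as
  many values as \<open>f\<close>.
\<close>

lemma card_image_le_of_factor:
  assumes "f ` A \<subseteq> B" "finite B" "\<And>x y. x \<in> A \<Longrightarrow> y \<in> A \<Longrightarrow> f x = f y \<Longrightarrow> g x = g y"
  shows "card (g ` A) \<le> card B"
proof -
  have *: "g ` A \<subseteq> (\<lambda>z. g (inv_into A f z)) ` (f ` A)"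
  proof
    fix y assume "y \<in> g ` A"
    then obtain x where x: "x \<in> A" "y = g x" by auto
    have "g (inv_into A f (f x)) = g x"
      using x by (intro assms(3)) (auto simp: inv_into_into f_inv_into_f)
    then show "y \<in> (\<lambda>z. g (inv_into A f z)) ` (f ` A)" using x by (metis imageI)
  qed
  have fin: "finite (f ` A)" using assms(1,2) by (rule finite_subset)
  have "card (g ` A) \<le> card (f ` A)"
    using * fin by (meson card_image_le card_mono finite_imageI le_trans)
  also have "\<dots> \<le> card B" using assms by (intro card_mono) auto
  finally show "card (g ` A) \<le> card B" .
qed

text \<open>
  The subgroup of the elements whose order divides \<open>n\<close> (for an abelian \<open>G\<close>), with the group structure
  inherited from \<open>G\<close>.
\<close>

definition torsion_part :: "('a, 'b) monoid_scheme \<Rightarrow> nat \<Rightarrow> ('a, 'b) monoid_scheme" where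
  "torsion_part G n = subgroup_generated G {x \<in> carrier G. x [^]\<^bsub>G\<^esub> n = \<one>\<^bsub>G\<^esub>}"

lemma (in comm_group) subgroup_torsion: "subgroup {x \<in> carrier G. x [^] (n::nat) = \<one>} G"
  by (rule subgroupI) (auto simp: nat_pow_inv nat_pow_distrib)

lemma (in comm_group) carrier_torsion_part:
  "carrier (torsion_part G n) = {x \<in> carrier G. x [^] n = \<one>}"
  unfolding torsion_part_def by (rule subgroup.carrier_subgroup_generated_subgroup[OF subgroup_torsion])

lemma (in comm_group) comm_group_torsion_part: "comm_group (torsion_part G n)"
  unfolding torsion_part_def by (rule abelian_subgroup_generated[OF comm_group_axioms])

lemma mult_torsion_part [simp]: "x \<otimes>\<^bsub>torsion_part G n\<^esub> y = x \<otimes>\<^bsub>G\<^esub> y"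
  by (simp add: torsion_part_def)

lemma torsion_part_cong:
  fixes G :: "('a, 'b) monoid_scheme" and H :: "('c, 'd) monoid_scheme"
  assumes G: "comm_group G" and H: "comm_group H" and "G \<cong> H"
  shows "torsion_part G n \<cong> torsion_part H n"
proof -
  interpret G: comm_group G by fact
  interpret H: comm_group H by fact
  obtain h where h: "h \<in> iso G H" using \<open>G \<cong> H\<close> by (auto simp: is_iso_def)
  then interpret h: group_hom G H h
    by unfold_locales (auto simp: iso_def)
  have inj: "inj_on h (carrier G)" and im: "h ` carrier G = carrier H"
    using h by (auto simp: iso_def bij_betw_def)
  have tor: "h x [^]\<^bsub>H\<^esub> n = \<one>\<^bsub>H\<^esub> \<longleftrightarrow> x [^]\<^bsub>G\<^esub> n = \<one>\<^bsub>G\<^esub>" if "x \<in> carrier G" for x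
  proof -
    have "h x [^]\<^bsub>H\<^esub> n = h (x [^]\<^bsub>G\<^esub> n)" using that by (simp add: h.hom_nat_pow)
    moreover have "\<one>\<^bsub>H\<^esub> = h \<one>\<^bsub>G\<^esub>" by simp
    ultimately show ?thesis using that inj by (metis G.nat_pow_closed G.one_closed inj_onD)
  qed
  have "h \<in> iso (torsion_part G n) (torsion_part H n)"
    unfolding iso_iff
  proof (intro conjI)
    show "h \<in> hom (torsion_part G n) (torsion_part H n)"
      using tor by (auto simp: hom_def G.carrier_torsion_part H.carrier_torsion_part)
    show "h ` carrier (torsion_part G n) = carrier (torsion_part H n)"
      unfolding G.carrier_torsion_part H.carrier_torsion_part using im tor by (auto simp: image_iff) (metis imageE)
    show "inj_on h (carrier (torsion_part G n))"
      using inj by (rule inj_on_subset) (auto simp: G.carrier_torsion_part)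
  qed
  then show ?thesis by (rule is_isoI)
qed

text \<open>
  Cauchy's theorem; a subgroup of order \<open>p\<close> exists by Sylow's theorem.
\<close>

lemma (in group) exists_elem_of_prime_order:
  assumes fin: "finite (carrier G)" and p: "prime p" "p dvd order G"
  obtains x where "x \<in> carrier G" "x \<noteq> \<one>" "x [^] p = \<one>"
proof -
  obtain H where H: "subgroup H G" "card H = p"
    using sylow_thm[OF p(1) group_axioms, of 1 "order G div p"] p fin by auto
  have "1 < card H" using H p prime_gt_1_nat by auto
  then have "\<not> H \<subseteq> {\<one>}" using card_mono[of "{\<one>}" H] by auto
  then obtain x where x: "x \<in> H" "x \<noteq> \<one>" by auto
  interpret HG: group "G\<lparr>carrier := H\<rparr>" using subgroup_imp_group[OF H(1)] .
  have "x [^]\<^bsub>G\<lparr>carrier := H\<rparr>\<^esub> order (G\<lparr>carrier := H\<rparr>) = \<one>"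
    using HG.pow_order_eq_1[of x] x by simp
  then have "x [^] p = \<one>" using H by (simp add: order_def nat_pow_consistent[symmetric])
  with that x H show ?thesis using subgroup.subset by blast
qed

text \<open>
  By Cauchy's theorem a prime dividing both numbers would produce an element whose order divides \<open>n\<close> and
  that prime, hence divides \<open>1\<close>.
\<close>

lemma (in comm_group) order_torsion_part_coprime:
  assumes fin: "finite (carrier G)" and "coprime n m"
  shows "coprime (order (torsion_part G n)) m"
proof (rule ccontr)
  assume "\<not> coprime (order (torsion_part G n)) m"
  then have "gcd (order (torsion_part G n)) m \<noteq> 1" by (simp add: coprime_iff_gcd_eq_1)
  then obtain p where "prime p" "p dvd gcd (order (torsion_part G n)) m"
    using prime_factor_nat by blast
  then have p: "prime p" "p dvd order (torsion_part G n)" "p dvd m" by auto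
  interpret T: comm_group "torsion_part G n" by (rule comm_group_torsion_part)
  have "finite (carrier (torsion_part G n))" using fin by (simp add: carrier_torsion_part)
  then obtain x where x: "x \<in> carrier (torsion_part G n)" "x \<noteq> \<one>\<^bsub>torsion_part G n\<^esub>" "x [^]\<^bsub>torsion_part G n\<^esub> p = \<one>\<^bsub>torsion_part G n\<^esub>"
    using T.exists_elem_of_prime_order[OF _ p(1,2)] by metis
  then have x': "x \<in> carrier G" "x [^] n = \<one>" "x \<noteq> \<one>" "x [^] p = \<one>"
    by (auto simp: carrier_torsion_part) (auto simp: torsion_part_def pow_subgroup_generated)
  then have "ord x dvd n" "ord x dvd p" by (auto simp: pow_eq_id)
  then have "ord x dvd 1" using \<open>coprime n m\<close> p(3) by (meson coprime_def dvd_trans)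
  then show False using x' ord_eq_1 by auto
qed

lemma (in comm_group) torsion_parts_decompose:
  assumes ord: "order G = n * m" and "n > 0" "m > 0" and cop: "coprime n m"
  shows "torsion_part G n \<times>\<times> torsion_part G m \<cong> G" "order (torsion_part G n) = n"
proof -
  have fin: "finite (carrier G)" using assms by (metis order_gt_0_iff_finite nat_0_less_mult_iff)
  let ?A = "{x \<in> carrier G. x [^] n = \<one>}" and ?B = "{x \<in> carrier G. x [^] m = \<one>}"
  have gds: "group_disjoint_sum G ?A ?B"
    by (rule group_disjoint_sum.intro[OF group_axioms subgroup_torsion subgroup_torsion])
  have disj: "?A \<inter> ?B \<subseteq> {\<one>}"
  proof
    fix x assume x: "x \<in> ?A \<inter> ?B"
    then have "ord x dvd n" "ord x dvd m" by (auto simp: pow_eq_id)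
    then have "ord x dvd 1" using cop by (meson coprime_def)
    then show "x \<in> {\<one>}" using x ord_eq_1 by auto
  qed
  have prod: "?A <#> ?B = carrier G"
  proof
    show "?A <#> ?B \<subseteq> carrier G" by (auto simp: set_mult_def)
    show "carrier G \<subseteq> ?A <#> ?B"
    proof
      fix g assume g: "g \<in> carrier G"
      obtain u v where uv: "u * int n + v * int m = 1"
        using cop bezout_int[of "int n" "int m"] by auto
      have ex: "g [^] (int n * int m * k) = \<one>" for k
      proof -
        have "ord g dvd n * m" using g ord_dvd_group_order by (simp add: ord)
        then have "int (ord g) dvd int n * int m * k" by (metis dvd_mult2 int_dvd_int_iff of_nat_mult)
        then show ?thesis using g int_pow_eq_id by blast
      qed
      have "g = g [^] (v * int m) \<otimes> g [^] (u * int n)"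
        using uv g by (simp add: add.commute flip: int_pow_mult)
      moreover have "g [^] (v * int m) \<in> ?A"
      proof -
        have "(g [^] (v * int m)) [^] int n = \<one>" 
          using g ex[of v] by (simp add: int_pow_pow mult_ac)
        then show ?thesis using g by (simp add: int_pow_int)
      qed
      moreover have "g [^] (u * int n) \<in> ?B"
      proof -
        have "(g [^] (u * int n)) [^] int m = \<one>" 
          using g ex[of u] by (simp add: int_pow_pow mult_ac)
        then show ?thesis using g by (simp add: int_pow_int)
      qed
      ultimately show "g \<in> ?A <#> ?B" unfolding set_mult_def by blast
    qed
  qed
  have "(\<lambda>(x,y). x \<otimes> y) \<in> iso (torsion_part G n \<times>\<times> torsion_part G m) G"
    unfolding torsion_part_def using group_disjoint_sum.iso_group_mul[OF gds comm_group_axioms] disj prod by blast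
  then show iso: "torsion_part G n \<times>\<times> torsion_part G m \<cong> G" by (rule is_isoI)
  have 1: "order (torsion_part G n) * order (torsion_part G m) = n * m"
    using iso_same_card[OF iso] ord by (simp add: order_def card_cartesian_product)
  have "order (torsion_part G n) dvd n"
    using order_torsion_part_coprime[OF fin cop] 1 by (metis coprime_dvd_mult_left_iff dvd_triv_left)
  moreover have "order (torsion_part G m) dvd m"
    using order_torsion_part_coprime[OF fin, of m n] cop 1
    by (metis coprime_commute coprime_dvd_mult_right_iff dvd_triv_right)
  ultimately obtain a b where ab: "n = order (torsion_part G n) * a" "m = order (torsion_part G m) * b" by (auto simp: dvd_def)
  then have "n * m = (order (torsion_part G n) * order (torsion_part G m)) * (a * b)" by (metis mult.assoc mult.commute)
  then have "a * b = 1" using 1 \<open>n > 0\<close> \<open>m > 0\<close> by auto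
  then show "order (torsion_part G n) = n" using ab by auto
qed

lemma comm_group_DirProd:
  assumes "comm_group G" "comm_group H" shows "comm_group (G \<times>\<times> H)"
proof -
  interpret G: comm_group G by fact
  interpret H: comm_group H by fact
  interpret group "G \<times>\<times> H" by (intro DirProd_group G.group_axioms H.group_axioms)
  show ?thesis by unfold_locales (auto simp: G.m_comm H.m_comm)
qed

lemma pow_DirProd: "(x, y) [^]\<^bsub>G \<times>\<times> H\<^esub> (n::nat) = (x [^]\<^bsub>G\<^esub> n, y [^]\<^bsub>H\<^esub> n)"
  by (induction n) auto

lemma torsion_part_DirProd:
  assumes "comm_group G" "comm_group H" "order G = n" "order H = m" "coprime n m"
  shows "G \<cong> torsion_part (G \<times>\<times> H) n"
proof -
  interpret G: comm_group G by fact
  interpret H: comm_group H by fact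
  interpret P: comm_group "G \<times>\<times> H" using assms by (simp add: comm_group_DirProd)
  have "y = \<one>\<^bsub>H\<^esub>" if "y \<in> carrier H" "y [^]\<^bsub>H\<^esub> n = \<one>\<^bsub>H\<^esub>" for y
  proof -
    have "H.ord y dvd n" "H.ord y dvd m" using that H.pow_eq_id H.ord_dvd_group_order assms by auto
    then have "H.ord y dvd 1" using assms by (meson coprime_def)
    then show ?thesis using that H.ord_eq_1 by auto
  qed
  then have "y [^]\<^bsub>H\<^esub> n = \<one>\<^bsub>H\<^esub> \<longleftrightarrow> y = \<one>\<^bsub>H\<^esub>" if "y \<in> carrier H" for y
    using that by auto
  moreover have "x [^]\<^bsub>G\<^esub> n = \<one>\<^bsub>G\<^esub>" if "x \<in> carrier G" for x
    using G.pow_order_eq_1[OF that] assms by simp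
  ultimately have car: "carrier (torsion_part (G \<times>\<times> H) n) = carrier G \<times> {\<one>\<^bsub>H\<^esub>}"
    unfolding P.carrier_torsion_part by (auto simp: pow_DirProd)
  have "(\<lambda>x. (x, \<one>\<^bsub>H\<^esub>)) \<in> iso G (torsion_part (G \<times>\<times> H) n)"
    unfolding iso_iff by (auto simp: hom_def car inj_on_def)
  then show ?thesis by (rule is_isoI)
qed

section \<open>Multiplicativity of the number of abelian groups\<close>

text \<open>
  Both inequalities come from maps that respect isomorphism: a group goes to its two torsion parts, and a
  pair of groups goes to its direct product, from which the factors are recovered as torsion parts.
\<close>

theorem num_abelian_groups_mult:
  assumes "n > 0" "m > 0" and cop: "coprime n m"
  shows "num_abelian_groups (n * m) = num_abelian_groups n * num_abelian_groups m"
proof (rule antisym)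
  let ?A = abelian_groups_of_order
  let ?B = "(iso_class ` ?A n) \<times> (iso_class ` ?A m)"
  have cardB: "card ?B = num_abelian_groups n * num_abelian_groups m"
    by (simp add: num_abelian_groups_altdef card_cartesian_product)
  let ?f = "\<lambda>G::nat monoid. (iso_class (torsion_part G n), iso_class (torsion_part G m))"
  have tor: "comm_group (torsion_part G n)" "finite (carrier (torsion_part G n))" 
    "comm_group (torsion_part G m)" "finite (carrier (torsion_part G m))"
    "order (torsion_part G n) = n" "order (torsion_part G m) = m"
    "torsion_part G n \<times>\<times> torsion_part G m \<cong> G" if "G \<in> ?A (n * m)" for G
  proof -
    interpret comm_group G using that by (simp add: abelian_groups_of_order_def)
    have o: "order G = n * m" "order G = m * n" "finite (carrier G)"
      using that by (auto simp: abelian_groups_of_order_def)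
    show "comm_group (torsion_part G n)" "comm_group (torsion_part G m)"
      by (rule comm_group_torsion_part)+
    show "order (torsion_part G n) = n" "order (torsion_part G m) = m"
      "torsion_part G n \<times>\<times> torsion_part G m \<cong> G"
      using torsion_parts_decompose[OF o(1) assms] torsion_parts_decompose[OF o(2) assms(2,1)] cop
      by (simp_all add: coprime_commute)
    show "finite (carrier (torsion_part G n))" "finite (carrier (torsion_part G m))"
      using o(3) by (simp_all add: carrier_torsion_part)
  qed
  have "card (iso_class ` ?A (n * m)) \<le> card ?B"
  proof (rule card_image_le_of_factor)
    show "?f ` ?A (n * m) \<subseteq> ?B"
    proof safe
      fix G assume G: "G \<in> ?A (n * m)"
      show "iso_class (torsion_part G n) \<in> iso_class ` ?A n"
        by (rule iso_class_in_image[OF tor(1,2,5)[OF G]])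
      show "iso_class (torsion_part G m) \<in> iso_class ` ?A m"
        by (rule iso_class_in_image[OF tor(3,4,6)[OF G]])
    qed
    show "finite ?B" by (simp add: finite_iso_class_image)
    fix G H assume G: "G \<in> ?A (n * m)" and H: "H \<in> ?A (n * m)" and eq: "?f G = ?f H"
    have "torsion_part G n \<cong> torsion_part H n"
      using eq iso_class_eq_iff[OF tor(1,2)[OF G] tor(1)[OF H]] by simp
    moreover have "torsion_part G m \<cong> torsion_part H m"
      using eq iso_class_eq_iff[OF tor(3,4)[OF G] tor(3)[OF H]] by simp
    ultimately have 1: "torsion_part G n \<times>\<times> torsion_part G m \<cong> torsion_part H n \<times>\<times> torsion_part H m"
      by (rule group.DirProd_iso_trans[OF comm_group.axioms(2)[OF tor(1)[OF G]]])
    interpret TG: comm_group "torsion_part G n \<times>\<times> torsion_part G m" using tor(1,3)[OF G] by (rule comm_group_DirProd)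
    have "G \<cong> torsion_part G n \<times>\<times> torsion_part G m"
      using tor(7)[OF G] by (rule TG.iso_sym)
    then have "G \<cong> H" by (rule iso_trans[OF iso_trans[OF _ 1] tor(7)[OF H]])
    then show "iso_class G = iso_class H"
      using G H iso_class_eq_iff[of G H] by (auto simp: abelian_groups_of_order_def)
  qed
  then show "num_abelian_groups (n * m) \<le> num_abelian_groups n * num_abelian_groups m"
    using cardB by (simp add: num_abelian_groups_altdef)
  let ?g = "\<lambda>(G::nat monoid, H::nat monoid). (iso_class G, iso_class H)"
  have "card (?g ` (?A n \<times> ?A m)) \<le> card (iso_class ` ?A (n * m))"
  proof (rule card_image_le_of_factor)
    have P: "comm_group (G \<times>\<times> H)" "finite (carrier (G \<times>\<times> H))" "order (G \<times>\<times> H) = n * m"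
      if "G \<in> ?A n" "H \<in> ?A m" for G H :: "nat monoid"
      using that by (auto simp: abelian_groups_of_order_def comm_group_DirProd order_def card_cartesian_product)
    show "(\<lambda>(G::nat monoid, H::nat monoid). iso_class (G \<times>\<times> H)) ` (?A n \<times> ?A m) \<subseteq> iso_class ` ?A (n * m)"
      using iso_class_in_image[OF P] by auto
    show "finite (iso_class ` ?A (n * m))" by (rule finite_iso_class_image)
    fix X Y :: "nat monoid \<times> nat monoid"
    assume X: "X \<in> ?A n \<times> ?A m" and Y: "Y \<in> ?A n \<times> ?A m"
      and eq: "(\<lambda>(G, H). iso_class (G \<times>\<times> H)) X = (\<lambda>(G, H). iso_class (G \<times>\<times> H)) Y"
    obtain G H G' H' where XY: "X = (G, H)" "Y = (G', H')" by (metis surj_pair)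
    have GA: "G \<in> ?A n" "G' \<in> ?A n" "H \<in> ?A m" "H' \<in> ?A m" using X Y XY by auto
    then have g: "comm_group G" "comm_group G'" "comm_group H" "comm_group H'"
      and o: "order G = n" "order G' = n" "order H = m" "order H' = m"
      and f: "finite (carrier G)" "finite (carrier G')" "finite (carrier H)" "finite (carrier H')"
      by (auto simp: abelian_groups_of_order_def)
    have 1: "G \<times>\<times> H \<cong> G' \<times>\<times> H'"
      using eq iso_class_eq_iff[OF P(1,2)[OF GA(1,3)] P(1)[OF GA(2,4)]] XY by simp
    have part: "A \<cong> A'" if "comm_group A" "comm_group A'" "comm_group B" "comm_group B'"
      "order A = k" "order A' = k" "order B = l" "order B' = l" "coprime k l" "A \<times>\<times> B \<cong> A' \<times>\<times> B'"
      for A A' B B' :: "nat monoid" and k l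
    proof -
      have "A \<cong> torsion_part (A \<times>\<times> B) k" "A' \<cong> torsion_part (A' \<times>\<times> B') k"
        using that by (auto intro: torsion_part_DirProd)
      moreover from this(2) have "torsion_part (A' \<times>\<times> B') k \<cong> A'"
        by (rule group.iso_sym[OF comm_group.axioms(2)[OF that(2)]])
      moreover have "torsion_part (A \<times>\<times> B) k \<cong> torsion_part (A' \<times>\<times> B') k"
        using that by (intro torsion_part_cong comm_group_DirProd)
      ultimately show ?thesis using iso_trans[OF iso_trans] by metis
    qed
    have "G \<cong> G'" using part[OF g o cop 1] .
    moreover have "H \<cong> H'"
    proof (rule part[OF g(3,4,1,2) o(3,4,1,2)])
      show "coprime m n" using cop by (simp add: coprime_commute)
      show "H \<times>\<times> G \<cong> H' \<times>\<times> G'"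
        by (rule iso_trans[OF iso_trans[OF DirProd_commute_iso 1] DirProd_commute_iso])
    qed
    ultimately show "?g X = ?g Y"
      using iso_class_eq_iff[OF g(1) f(1) g(2)] iso_class_eq_iff[OF g(3) f(3) g(4)] XY by simp
  qed
  moreover have "?g ` (?A n \<times> ?A m) = ?B" by force
  ultimately show "num_abelian_groups n * num_abelian_groups m \<le> num_abelian_groups (n * m)"
    using cardB by (simp add: num_abelian_groups_altdef)
qed

lemma num_abelian_groups_pos:
  assumes "n > 0" shows "num_abelian_groups n > 0"
proof -
  have "iso_class (integer_mod_group n) \<in> iso_class ` abelian_groups_of_order n"
    using assms by (intro iso_class_in_image) (auto simp: order_def carrier_integer_mod_group)
  then show ?thesis
    using finite_iso_class_image by (auto simp: num_abelian_groups_altdef card_gt_0_iff)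
qed

section \<open>Abelian groups of prime power order\<close>

text \<open>
  The abelian groups on natural numbers of order \<open>p\<^sup>k\<close> with exponent dividing \<open>p\<^sup>j\<close>.
\<close>

definition abelian_p_groups :: "nat \<Rightarrow> nat \<Rightarrow> nat \<Rightarrow> nat monoid set" where
  "abelian_p_groups p k j =
     {G \<in> abelian_groups_of_order (p ^ k). \<forall>x\<in>carrier G. x [^]\<^bsub>G\<^esub> (p ^ j) = \<one>\<^bsub>G\<^esub>}"

lemma finite_iso_class_p_groups: "finite (iso_class ` abelian_p_groups p k j)"
  by (rule finite_subset[OF _ finite_iso_class_image[of "p ^ k"]]) (auto simp: abelian_p_groups_def)

lemma abelian_p_groups_full: "abelian_p_groups p k k = abelian_groups_of_order (p ^ k)"
  unfolding abelian_p_groups_def abelian_groups_of_order_def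
  by (auto simp: comm_group_def) (metis group.pow_order_eq_1)

text \<open>
  An abelian group of order \<open>p\<^sup>k\<close> whose exponent is exactly \<open>p\<^sup>j\<^sup>+\<^sup>1\<close> is a product of a cyclic group of that
  order and a smaller group whose exponent still divides \<open>p\<^sup>j\<^sup>+\<^sup>1\<close>.
\<close>

lemma (in comm_group) split_off_cyclic:
  assumes p: "prime p" and fin: "finite (carrier G)" and ord: "order G = p ^ k"
    and ex: "\<And>g. g \<in> carrier G \<Longrightarrow> g [^] (p ^ Suc j) = \<one>"
    and x: "x \<in> carrier G" "x [^] (p ^ j) \<noteq> \<one>"
  obtains K :: "nat monoid" where "Suc j \<le> k" "K \<in> abelian_p_groups p (k - Suc j) (Suc j)"
    "G \<cong> integer_mod_group (p ^ Suc j) \<times>\<times> K"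
proof -
  have "ord x dvd p ^ Suc j" "\<not> ord x dvd p ^ j" using x ex[of x] by (auto simp: pow_eq_id)
  then have ox: "ord x = p ^ Suc j"
    using p by (metis divides_primepow_nat le_Suc_eq le_imp_power_dvd)
  obtain K where K: "subgroup K G" and CK: "range (\<lambda>n::int. x [^] n) \<inter> K = {\<one>}"
    and prod: "range (\<lambda>n::int. x [^] n) <#> K = carrier G"
    using cyclic_complement[OF fin x(1) p ox ex] by blast
  let ?C = "range (\<lambda>n::int. x [^] n)"
  let ?K = "subgroup_generated G K"
  have carK: "carrier ?K = K" using K by (rule subgroup.carrier_subgroup_generated_subgroup)
  have C: "subgroup ?C G" using x(1) by (rule subgroup_of_powers)
  have gds: "group_disjoint_sum G ?C K"
    by (rule group_disjoint_sum.intro[OF group_axioms C K])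
  have "(\<lambda>(x,y). x \<otimes> y) \<in> iso (subgroup_generated G ?C \<times>\<times> ?K) G"
    using group_disjoint_sum.iso_group_mul[OF gds comm_group_axioms] CK prod by blast
  then have iso1: "subgroup_generated G ?C \<times>\<times> ?K \<cong> G" by (rule is_isoI)
  have iso2: "integer_mod_group (p ^ Suc j) \<cong> subgroup_generated G ?C"
    using p by (intro powers_iso_integer_mod[OF x(1) ox]) (simp add: prime_gt_0_nat)
  have cK: "comm_group ?K" by (rule abelian_subgroup_generated[OF comm_group_axioms])
  have fK: "finite (carrier ?K)" using carK fin subgroup.subset[OF K] finite_subset by auto
  obtain K' :: "nat monoid" where K': "K' \<in> abelian_groups_of_order (order ?K)" "?K \<cong> K'"
    using abelian_group_representative[OF cK fK] by metis
  interpret K': comm_group K' using K' by (simp add: abelian_groups_of_order_def)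
  interpret SK: comm_group ?K by (rule cK)
  have KK': "K' \<cong> ?K" using K'(2) by (rule SK.iso_sym)
  have iso3: "integer_mod_group (p ^ Suc j) \<times>\<times> K' \<cong> G"
    by (rule iso_trans[OF group.DirProd_iso_trans[OF group_integer_mod_group iso2 KK'] iso1])
  interpret P: comm_group "integer_mod_group (p ^ Suc j) \<times>\<times> K'"
    by (intro comm_group_DirProd abelian_integer_mod_group K'.comm_group_axioms)
  have iso4: "G \<cong> integer_mod_group (p ^ Suc j) \<times>\<times> K'" using iso3 by (rule P.iso_sym)
  have "p ^ Suc j * order ?K = p ^ k"
  proof -
    have "card (carrier (integer_mod_group (p ^ Suc j) \<times>\<times> K')) = p ^ k"
      using iso_same_card[OF iso4] ord by (simp add: order_def)
    moreover have "card (carrier K') = order ?K" using iso_same_card[OF KK'] by (simp add: order_def)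
    moreover have "card (carrier (integer_mod_group (p ^ Suc j))) = p ^ Suc j"
    proof -
      have "card (carrier (integer_mod_group n)) = n" if "n > 0" for n
        using that by (simp add: carrier_integer_mod_group)
      then show ?thesis using p prime_gt_0_nat by simp
    qed
    ultimately show ?thesis by (simp add: card_cartesian_product)
  qed
  moreover from this have le: "Suc j \<le> k"
    using p by (metis dvd_triv_left power_dvd_imp_le prime_gt_1_nat)
  ultimately have oK: "order ?K = p ^ (k - Suc j)"
    using p by (metis le_add_diff_inverse mult_cancel_left power_add power_not_zero not_prime_0)
  have "y [^]\<^bsub>K'\<^esub> (p ^ Suc j) = \<one>\<^bsub>K'\<^esub>" if y: "y \<in> carrier K'" for y
  proof -
    obtain h where h: "h \<in> iso ?K K'" using K'(2) by (auto simp: is_iso_def)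
    then interpret h: group_hom ?K K' h by unfold_locales (auto simp: iso_def)
    have "h ` K = carrier K'" using h carK by (simp add: iso_def bij_betw_def)
    then obtain z where z: "z \<in> K" "y = h z" using y by auto
    have "y [^]\<^bsub>K'\<^esub> (p ^ Suc j) = h (z [^]\<^bsub>?K\<^esub> (p ^ Suc j))"
      unfolding z using z carK h.hom_nat_pow by simp
    also have "z [^]\<^bsub>?K\<^esub> (p ^ Suc j) = \<one>\<^bsub>?K\<^esub>"
      using ex[of z] z subgroup.subset[OF K] by (auto simp: pow_subgroup_generated)
    finally show ?thesis by (simp only: h.hom_one)
  qed
  then have "K' \<in> abelian_p_groups p (k - Suc j) (Suc j)"
    using K'(1) oK by (simp add: abelian_p_groups_def)
  with that le iso4 show ?thesis by blast
qed

text \<open>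
  This is the recursion for partitions of \<open>k\<close> into parts of size at most \<open>j + 1\<close>: either no part equals
  \<open>j + 1\<close>, or one such part is removed. Groups with isomorphic remaining factors are isomorphic.
\<close>

lemma card_p_groups_Suc:
  assumes p: "prime p"
  shows "card (iso_class ` abelian_p_groups p k (Suc j)) \<le>
    card (iso_class ` abelian_p_groups p k j) +
    (if Suc j \<le> k then card (iso_class ` abelian_p_groups p (k - Suc j) (Suc j)) else 0)"
proof -
  let ?D = "abelian_p_groups p k (Suc j) - abelian_p_groups p k j"
  let ?Z = "integer_mod_group (p ^ Suc j)"
  have split: "Suc j \<le> k \<and> (\<exists>K::nat monoid. K \<in> abelian_p_groups p (k - Suc j) (Suc j) \<and> G \<cong> ?Z \<times>\<times> K)"
    if D: "G \<in> ?D" for G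
  proof -
    have G: "comm_group G" "finite (carrier G)" "order G = p ^ k"
      "\<And>g. g \<in> carrier G \<Longrightarrow> g [^]\<^bsub>G\<^esub> (p ^ Suc j) = \<one>\<^bsub>G\<^esub>"
      using that by (auto simp: abelian_p_groups_def abelian_groups_of_order_def)
    obtain x where "x \<in> carrier G" "x [^]\<^bsub>G\<^esub> (p ^ j) \<noteq> \<one>\<^bsub>G\<^esub>"
      using D by (auto simp: abelian_p_groups_def)
    from comm_group.split_off_cyclic[OF G(1) p G(2-4) this] show ?thesis by blast
  qed
  have "card (iso_class ` abelian_p_groups p k (Suc j))
      \<le> card (iso_class ` abelian_p_groups p k j \<union> iso_class ` ?D)"
    by (intro card_mono) (auto simp: finite_iso_class_p_groups intro: finite_subset[OF _ finite_iso_class_p_groups])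
  also have "\<dots> \<le> card (iso_class ` abelian_p_groups p k j) + card (iso_class ` ?D)"
    by (rule card_Un_le)
  also have "card (iso_class ` ?D) \<le>
    (if Suc j \<le> k then card (iso_class ` abelian_p_groups p (k - Suc j) (Suc j)) else 0)"
  proof (cases "Suc j \<le> k")
    case False
    then have "?D = {}" using split by blast
    then show ?thesis using False by (simp only: image_empty card.empty)
  next
    case True
    define F where "F G = (SOME K::nat monoid. K \<in> abelian_p_groups p (k - Suc j) (Suc j) \<and> G \<cong> ?Z \<times>\<times> K)"
      for G :: "nat monoid"
    have F: "F G \<in> abelian_p_groups p (k - Suc j) (Suc j)" "G \<cong> ?Z \<times>\<times> F G" if "G \<in> ?D" for G
    proof -
      have "\<exists>K::nat monoid. K \<in> abelian_p_groups p (k - Suc j) (Suc j) \<and> G \<cong> ?Z \<times>\<times> K"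
        using split[OF that] by blast
      then have "F G \<in> abelian_p_groups p (k - Suc j) (Suc j) \<and> G \<cong> ?Z \<times>\<times> F G"
        unfolding F_def by (rule someI_ex)
      then show "F G \<in> abelian_p_groups p (k - Suc j) (Suc j)" "G \<cong> ?Z \<times>\<times> F G" by auto
    qed
    have "card (iso_class ` ?D) \<le> card (iso_class ` abelian_p_groups p (k - Suc j) (Suc j))"
    proof (rule card_image_le_of_factor[where f = "\<lambda>G. iso_class (F G)"])
      show "(\<lambda>G. iso_class (F G)) ` ?D \<subseteq> iso_class ` abelian_p_groups p (k - Suc j) (Suc j)"
        using F(1) by blast
      fix G H assume G: "G \<in> ?D" and H: "H \<in> ?D" and eq: "iso_class (F G) = iso_class (F H)"
      have cG: "comm_group G" "finite (carrier G)" "comm_group H"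
        using G H by (auto simp: abelian_p_groups_def abelian_groups_of_order_def)
      have cF: "comm_group (F G)" "finite (carrier (F G))" "comm_group (F H)"
        using F(1)[OF G] F(1)[OF H] by (auto simp: abelian_p_groups_def abelian_groups_of_order_def)
      have "F G \<cong> F H" using eq iso_class_eq_iff[OF cF] by simp
      then have 1: "?Z \<times>\<times> F G \<cong> ?Z \<times>\<times> F H"
        by (rule group.DirProd_iso_trans[OF group_integer_mod_group iso_refl])
      have 2: "?Z \<times>\<times> F H \<cong> H"
        by (rule group.iso_sym[OF comm_group.axioms(2)[OF cG(3)] F(2)[OF H]])
      have "G \<cong> H" by (rule iso_trans[OF F(2)[OF G] iso_trans[OF 1 2]])
      then show "iso_class G = iso_class H" using iso_class_eq_iff[OF cG] by simp
    qed (rule finite_iso_class_p_groups)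
    then show ?thesis using True by simp
  qed
  finally show ?thesis by simp
qed

lemma card_p_groups_0:
  assumes p: "prime p"
  shows "card (iso_class ` abelian_p_groups p k 0) \<le> (if k = 0 then 1 else 0)"
proof -
  have tr: "carrier G = {\<one>\<^bsub>G\<^esub>}" "k = 0" if "G \<in> abelian_p_groups p k 0" for G
  proof -
    interpret comm_group G using that by (simp add: abelian_p_groups_def abelian_groups_of_order_def)
    show "carrier G = {\<one>\<^bsub>G\<^esub>}" using that by (auto simp: abelian_p_groups_def)
    then have "p ^ k = 1" using that by (auto simp: abelian_p_groups_def abelian_groups_of_order_def order_def)
    then show "k = 0" using p prime_gt_1_nat[OF p] by simp
  qed
  show ?thesis
  proof (cases "k = 0")
    case True
    have "card (iso_class ` abelian_p_groups p k 0) \<le> card {()}"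
    proof (rule card_image_le_of_factor[where f = "\<lambda>_. ()"])
      fix G H assume GH: "G \<in> abelian_p_groups p k 0" "H \<in> abelian_p_groups p k 0"
      then have c: "comm_group G" "finite (carrier G)" "comm_group H"
        by (auto simp: abelian_p_groups_def abelian_groups_of_order_def)
      interpret G: comm_group G by fact
      interpret H: comm_group H by fact
      have "(\<lambda>_. \<one>\<^bsub>H\<^esub>) \<in> iso G H"
        using tr[OF GH(1)] tr[OF GH(2)] by (auto simp: iso_iff hom_def)
      then show "iso_class G = iso_class H" using iso_class_eq_iff[OF c] is_isoI by blast
    qed auto
    then show ?thesis using True by simp
  next
    case False
    then have "abelian_p_groups p k 0 = {}" using tr by auto
    then show ?thesis by simp
  qed
qed

text \<open>
  The recursion is satisfied with equality by \<open>z\<^sup>-\<^sup>k\<close> times a partial product \<open>P\<close> of Euler's product, because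
  \<open>P (1 - z ^ (j + 1)) + P z ^ (j + 1) = P\<close>.
\<close>

lemma card_p_groups_bound:
  fixes z :: real
  assumes p: "prime p" and z: "0 < z" "z < 1"
  shows "real (card (iso_class ` abelian_p_groups p k j)) \<le> (\<Prod>i=1..j. 1 / (1 - z ^ i)) / z ^ k"
proof (induction j arbitrary: k)
  case 0
  have "real (card (iso_class ` abelian_p_groups p k 0)) \<le> (if k = 0 then 1 else 0)"
    using card_p_groups_0[OF p, of k] by (auto split: if_splits)
  also have "\<dots> \<le> 1 / z ^ k" using z by simp
  finally show ?case by simp
next
  case (Suc j)
  define P' P where "P' = (\<Prod>i=1..j. 1 / (1 - z ^ i))" and "P = (\<Prod>i=1..Suc j. 1 / (1 - z ^ i))"
  have lt1: "z ^ i < 1" if "i > 0" for i using z that by (simp add: power_less_one_iff)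
  have P: "P' = P * (1 - z ^ Suc j)" using lt1[of "Suc j"] by (simp add: P_def P'_def)
  have P0: "P \<ge> 0" unfolding P_def using lt1 by (intro prod_nonneg) (auto simp: less_imp_le)
  have "real (card (iso_class ` abelian_p_groups p k (Suc j))) \<le> P / z ^ k"
  proof (induction k rule: less_induct)
    case (less k)
    have "real (card (iso_class ` abelian_p_groups p k (Suc j))) \<le>
      real (card (iso_class ` abelian_p_groups p k j)) +
      (if Suc j \<le> k then real (card (iso_class ` abelian_p_groups p (k - Suc j) (Suc j))) else 0)"
      using card_p_groups_Suc[OF p, of k j] by (auto split: if_splits)
    also have "\<dots> \<le> P' / z ^ k + P * z ^ Suc j / z ^ k"
    proof (rule add_mono)
      show "real (card (iso_class ` abelian_p_groups p k j)) \<le> P' / z ^ k"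
        using Suc.IH[of k] by (simp add: P'_def)
      show "(if Suc j \<le> k then real (card (iso_class ` abelian_p_groups p (k - Suc j) (Suc j))) else 0)
        \<le> P * z ^ Suc j / z ^ k"
      proof (cases "Suc j \<le> k")
        case True
        then have "real (card (iso_class ` abelian_p_groups p (k - Suc j) (Suc j))) \<le> P / z ^ (k - Suc j)"
          by (intro less) auto
        also have "\<dots> = P * z ^ Suc j / z ^ k"
          using True z by (simp add: power_diff del: power_Suc)
        finally show ?thesis using True by simp
      qed (use P0 z in simp)
    qed
    also have "\<dots> = P / z ^ k" unfolding P by (simp add: algebra_simps add_divide_distrib diff_divide_distrib)
    finally show ?case .
  qed
  then show ?case by (simp add: P_def)
qed

lemma prod_euler_bounded:
  fixes z :: real
  assumes z: "0 < z" "z < 1"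
  shows "(\<Prod>i=1..j. 1 / (1 - z ^ i)) \<le> exp (z / (1 - z) ^ 2)"
proof -
  have "1 / (1 - z ^ i) \<le> exp (z ^ i / (1 - z))" if "i \<ge> 1" for i
  proof -
    have le: "z ^ i \<le> z" using z that power_decreasing[of 1 i z] by simp
    have "1 / (1 - z ^ i) = 1 + z ^ i / (1 - z ^ i)" using le z by (simp add: field_simps)
    also have "\<dots> \<le> 1 + z ^ i / (1 - z)" using le z by (intro add_left_mono divide_left_mono) auto
    also have "\<dots> \<le> exp (z ^ i / (1 - z))" by (rule exp_ge_add_one_self)
    finally show ?thesis .
  qed
  moreover have "0 \<le> 1 / (1 - z ^ i)" if "i \<ge> 1" for i
    using z power_le_one[of z i] by simp
  ultimately have "(\<Prod>i=1..j. 1 / (1 - z ^ i)) \<le> (\<Prod>i=1..j. exp (z ^ i / (1 - z)))"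
    by (intro prod_mono) auto
  also have "\<dots> = exp ((\<Sum>i=1..j. z ^ i) / (1 - z))" by (simp add: exp_sum sum_divide_distrib)
  also have "(\<Sum>i=1..j. z ^ i) \<le> z / (1 - z)"
  proof (cases "j \<ge> 1")
    case True
    have "(\<Sum>i=1..j. z ^ i) = (z - z ^ Suc j) / (1 - z)"
      using z True by (subst sum_gp) auto
    also have "\<dots> \<le> z / (1 - z)" using z by (intro divide_right_mono) auto
    finally show ?thesis .
  qed (use z in auto)
  finally show ?thesis using z by (simp add: divide_right_mono power2_eq_square)
qed

lemma num_abelian_groups_prime_power_bound:
  fixes z :: real
  assumes "prime p" "0 < z" "z < 1"
  shows "real (num_abelian_groups (p ^ k)) \<le> exp (z / (1 - z) ^ 2) / z ^ k"
proof -
  have "real (num_abelian_groups (p ^ k)) \<le> (\<Prod>i=1..k. 1 / (1 - z ^ i)) / z ^ k"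
    using card_p_groups_bound[OF assms, of k k] by (simp add: num_abelian_groups_altdef abelian_p_groups_full)
  also have "\<dots> \<le> exp (z / (1 - z) ^ 2) / z ^ k"
    using assms prod_euler_bounded by (intro divide_right_mono) auto
  finally show ?thesis .
qed

lemma num_abelian_groups_prime:
  assumes "prime p" shows "num_abelian_groups p = 1"
proof -
  have "num_abelian_groups p \<le> 1"
    using card_p_groups_Suc[OF assms, of 1 0] card_p_groups_Suc[OF assms, of 0 0]
      card_p_groups_0[OF assms, of 1] card_p_groups_0[OF assms, of 0] abelian_p_groups_full[of p 1]
    by (simp add: num_abelian_groups_altdef)
  moreover have "num_abelian_groups p > 0" using assms num_abelian_groups_pos prime_gt_0_nat by blast
  ultimately show ?thesis by simp
qed

lemma num_abelian_groups_prime_mult: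
  assumes p: "prime p" and "\<not> p dvd m"
  shows "num_abelian_groups (p * m) = num_abelian_groups m"
proof -
  have "m > 0" using assms by (intro Nat.gr0I) auto
  then show ?thesis
    using assms num_abelian_groups_mult[of p m] num_abelian_groups_prime[OF p] prime_gt_0_nat[OF p]
    by (simp add: prime_imp_coprime)
qed

section \<open>Growth of multiplicative functions\<close>

text \<open>
  The hypothesis on prime powers says that \<open>f (p ^ k)\<close> grows subexponentially in \<open>k\<close>, uniformly in \<open>p\<close>. With
  \<open>z = 2 powr (- \<epsilon>)\<close> it costs a constant factor for each prime; for large primes the choice
  \<open>z = 1/2\<close> makes that factor unnecessary, so that only boundedly many primes contribute one.
\<close>

lemma submultiplicative_growth:
  fixes f :: "nat \<Rightarrow> real"
  assumes nonneg: "\<And>n. f n \<ge> 0" and f1: "f 1 \<le> 1"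
    and mult: "\<And>p k m. prime p \<Longrightarrow> m > 0 \<Longrightarrow> \<not> p dvd m \<Longrightarrow> f (p ^ k * m) \<le> f (p ^ k) * f m"
    and pp: "\<And>z. 0 < z \<Longrightarrow> z < 1 \<Longrightarrow> \<exists>M. \<forall>p k. prime p \<longrightarrow> f (p ^ k) \<le> M / z ^ k"
    and \<epsilon>: "\<epsilon> > 0"
  shows "\<exists>K>0. \<forall>n>0. f n \<le> K * real n powr \<epsilon>"
proof -
  define z where "z = 2 powr (- \<epsilon>)"
  have z: "0 < z" "z < 1" using \<epsilon> by (auto simp: z_def powr_less_one)
  obtain M where M: "\<And>p k. prime p \<Longrightarrow> f (p ^ k) \<le> M / z ^ k" using pp[OF z] by blast
  obtain N where N: "\<And>p k. prime p \<Longrightarrow> f (p ^ k) \<le> N / (1/2) ^ k" using pp[of "1/2"] by auto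
  define M' where "M' = max M 1"
  define N' where "N' = max N 1"
  have M'1: "M' \<ge> 1" and N'1: "N' \<ge> 1" by (auto simp: M'_def N'_def)
  have prw: "(real p powr \<epsilon>) ^ k = real (p ^ k) powr \<epsilon>" if "prime p" for p k
    using that prime_gt_0_nat[OF that] by (simp add: powr_realpow[symmetric] powr_powr mult.commute)
  have small: "f (p ^ k) \<le> M' * real (p ^ k) powr \<epsilon>" if p: "prime p" for p k
  proof -
    have "f (p ^ k) \<le> M / z ^ k" using M[OF p] .
    also have "\<dots> \<le> M' / z ^ k" using z by (intro divide_right_mono) (auto simp: M'_def)
    also have "\<dots> = M' * (2 powr \<epsilon>) ^ k" by (simp add: z_def powr_minus power_inverse divide_inverse)
    also have "\<dots> \<le> M' * (real p powr \<epsilon>) ^ k"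
      using prime_ge_2_nat[OF p] \<epsilon> M'1 by (intro mult_left_mono power_mono powr_mono2) auto
    finally show ?thesis using prw[OF p] by simp
  qed
  define P where "P = nat \<lceil>(2 * N') powr (1 / \<epsilon>)\<rceil>"
  have large: "f (p ^ k) \<le> real (p ^ k) powr \<epsilon>" if p: "prime p" "p \<ge> P" and k: "k > 0" for p k
  proof -
    have "(2 * N') powr (1 / \<epsilon>) \<le> real p" using p(2) unfolding P_def by linarith
    then have "((2 * N') powr (1 / \<epsilon>)) powr \<epsilon> \<le> real p powr \<epsilon>" using \<epsilon> by (intro powr_mono2) auto
    then have le: "2 * N' \<le> real p powr \<epsilon>" using \<epsilon> N'1 by (simp add: powr_powr)
    have "f (p ^ k) \<le> N * 2 ^ k" using N[OF p(1), of k] by (simp add: power_one_over)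
    also have "\<dots> \<le> N' ^ k * 2 ^ k"
    proof (rule mult_right_mono)
      have "N \<le> N' ^ 1" by (simp add: N'_def)
      also have "\<dots> \<le> N' ^ k" using k N'1 by (intro power_increasing) auto
      finally show "N \<le> N' ^ k" .
    qed simp
    also have "\<dots> = (2 * N') ^ k" by (simp add: power_mult_distrib)
    also have "\<dots> \<le> (real p powr \<epsilon>) ^ k" using le N'1 by (intro power_mono) auto
    finally show ?thesis using prw[OF p(1)] by simp
  qed
  \<comment> \<open>One factor \<open>M'\<close> for each prime divisor below the threshold \<open>P\<close>.\<close>
  have main: "f n \<le> M' ^ card {p. prime p \<and> p dvd n \<and> p < P} * real n powr \<epsilon>" if "n > 0" for n
    using that
  proof (induction n rule: less_induct)
    case (less n)
    show ?case
    proof (cases "n = 1")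
      case True
      have "f n \<le> 1" using f1 True by simp
      also have "\<dots> \<le> M' ^ card {p. prime p \<and> p dvd n \<and> p < P}" using M'1 by (rule one_le_power)
      finally show ?thesis using True by simp
    next
      case False
      then obtain p where p: "prime p" "p dvd n" using prime_factor_nat by blast
      obtain m where m: "n = p ^ multiplicity p n * m" "\<not> p dvd m"
        using multiplicity_decompose'[of n p] less.prems p(1) not_prime_unit by (metis neq0_conv)
      define k where "k = multiplicity p n"
      have k: "k > 0" using p less.prems unfolding k_def by (simp add: prime_multiplicity_gt_zero_iff)
      have n: "n = p ^ k * m" using m k_def by simp
      have m0: "m > 0" using m(2) by (intro Nat.gr0I) auto
      have "1 < p ^ k" using prime_gt_1_nat[OF p(1)] k by (rule one_less_power)
      then have mn: "m < n" using n m0 by simp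
      let ?S = "\<lambda>n. {p. prime p \<and> p dvd n \<and> p < P}"
      have S: "?S n = ?S m \<union> (if p < P then {p} else {})"
        using p k n by (auto simp: prime_dvd_mult_iff prime_dvd_power_iff dest: primes_dvd_imp_eq)
      have pm: "p \<notin> ?S m" using m by auto
      have fin: "finite (?S m)" by (rule finite_subset[of _ "{..<P}"]) auto
      have pk: "f (p ^ k) \<le> (if p < P then M' else 1) * real (p ^ k) powr \<epsilon>"
        using small[OF p(1)] large[OF p(1) _ k] by auto
      have "f n \<le> f (p ^ k) * f m" unfolding n using mult[OF p(1) m0 m(2)] .
      also have "\<dots> \<le> ((if p < P then M' else 1) * real (p ^ k) powr \<epsilon>) * (M' ^ card (?S m) * real m powr \<epsilon>)"
        using pk less.IH[OF mn m0] nonneg M'1 by (intro mult_mono) auto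
      also have "\<dots> = ((if p < P then M' else 1) * M' ^ card (?S m)) * real n powr \<epsilon>"
        using n by (simp add: powr_mult)
      also have "(if p < P then M' else 1) * M' ^ card (?S m) = M' ^ card (?S n)"
        unfolding S using fin card_insert_disjoint[OF fin pm] by simp
      finally show ?thesis .
    qed
  qed
  have "f n \<le> M' ^ P * real n powr \<epsilon>" if "n > 0" for n
  proof -
    have "card {p. prime p \<and> p dvd n \<and> p < P} \<le> card {..<P}" by (intro card_mono) auto
    then have "M' ^ card {p. prime p \<and> p dvd n \<and> p < P} \<le> M' ^ P"
      using M'1 by (intro power_increasing) auto
    then have "M' ^ card {p. prime p \<and> p dvd n \<and> p < P} * real n powr \<epsilon> \<le> M' ^ P * real n powr \<epsilon>"
      by (intro mult_right_mono) auto
    then show ?thesis using main[OF that] by linarith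
  qed
  moreover have "M' ^ P > 0" using M'1 by simp
  ultimately show ?thesis by blast
qed

lemma num_abelian_groups_growth:
  fixes \<epsilon> :: real assumes "\<epsilon> > 0"
  shows "\<exists>K>0. \<forall>n>0. real (num_abelian_groups n) \<le> K * real n powr \<epsilon>"
proof (rule submultiplicative_growth)
  show "real (num_abelian_groups 1) \<le> 1"
    using num_abelian_groups_mult[of 1 1] by force
  fix p k m :: nat assume "prime p" "m > 0" "\<not> p dvd m"
  then show "real (num_abelian_groups (p ^ k * m)) \<le> real (num_abelian_groups (p ^ k)) * real (num_abelian_groups m)"
    using num_abelian_groups_mult[of "p ^ k" m] by (simp add: prime_gt_0_nat prime_imp_coprime)
next
  fix z :: real assume "0 < z" "z < 1"
  then show "\<exists>M. \<forall>p k. prime p \<longrightarrow> real (num_abelian_groups (p ^ k)) \<le> M / z ^ k"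
    using num_abelian_groups_prime_power_bound by blast
qed (use assms in auto)

lemma card_divisors_growth:
  fixes \<epsilon> :: real assumes "\<epsilon> > 0"
  shows "\<exists>K>0. \<forall>n>0. real (card {d. d dvd n}) \<le> K * real (n::nat) powr \<epsilon>"
proof (rule submultiplicative_growth)
  fix p k m :: nat assume A: "prime p" "m > 0" "\<not> p dvd m"
  have "{d. d dvd p ^ k * m} \<subseteq> (\<lambda>(a, b). a * b) ` ({d. d dvd p ^ k} \<times> {d. d dvd m})"
    by (auto elim!: dvd_productE)
  then have "card {d. d dvd p ^ k * m} \<le> card ({d. d dvd p ^ k} \<times> {d. d dvd m})"
    using A by (intro surj_card_le) (auto simp: prime_gt_0_nat)
  then show "real (card {d. d dvd p ^ k * m}) \<le> real (card {d. d dvd p ^ k}) * real (card {d. d dvd m})"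
    by (simp add: card_cartesian_product flip: of_nat_mult)
next
  fix z :: real assume z: "0 < z" "z < 1"
  have "real (card {d. d dvd p ^ k}) \<le> (1 / (1 - z)) / z ^ k" if p: "prime p" for p :: nat and k
  proof -
    have "{d. d dvd p ^ k} = (\<lambda>i. p ^ i) ` {..k}" using p by (auto simp: divides_primepow_nat)
    then have "card {d. d dvd p ^ k} \<le> card {..k}" using card_image_le[of "{..k}" "\<lambda>i. p ^ i"] by simp
    then have "real (card {d. d dvd p ^ k}) * z ^ k \<le> (\<Sum>i\<le>k. z ^ k)"
      using z by (simp add: mult_right_mono)
    also have "\<dots> \<le> (\<Sum>i\<le>k. z ^ i)" using z by (intro sum_mono power_decreasing) auto
    also have "\<dots> = (1 - z ^ Suc k) / (1 - z)" using z by (subst sum_gp0) auto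
    also have "\<dots> \<le> 1 / (1 - z)" using z by (intro divide_right_mono) auto
    finally show ?thesis using z by (simp add: field_simps)
  qed
  then show "\<exists>M. \<forall>p k. prime p \<longrightarrow> real (card {d. d dvd (p::nat) ^ k}) \<le> M / z ^ k"
    by blast
qed (use assms in auto)

section \<open>Moebius inversion\<close>

text \<open>
  The Moebius function. Zero is not squarefree, so its value there is \<open>0\<close>.
\<close>

definition moebius :: "nat \<Rightarrow> int" where
  "moebius n = (if squarefree n then (- 1) ^ card (prime_factors n) else 0)"

lemma abs_moebius_le: "\<bar>moebius n\<bar> \<le> 1"
  by (simp add: moebius_def power_abs)

lemma moebius_prime_mult:
  assumes p: "prime p" "\<not> p dvd n"
  shows "moebius (p * n) = - moebius n"
proof -
  have n0: "n \<noteq> 0" using p by (metis dvd_0_right)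
  have cop: "coprime p n" using p by (simp add: prime_imp_coprime)
  have "squarefree (p * n) \<longleftrightarrow> squarefree n"
    using p cop squarefree_mult_coprime[OF cop] squarefree_multD[of p n] by (auto simp: squarefree_prime)
  moreover have "prime_factors (p * n) = insert p (prime_factors n)"
    using p n0 by (auto simp: prime_factors_product prime_prime_factors)
  moreover have "p \<notin> prime_factors n" using p by auto
  ultimately show ?thesis by (simp add: moebius_def)
qed

lemma moebius_square_dvd: "prime p \<Longrightarrow> p ^ 2 dvd n \<Longrightarrow> moebius n = 0"
  using squarefreeD[of n p] by (auto simp: moebius_def)

lemma divisors_prime_mult:
  fixes p m :: nat
  assumes p: "prime p" and "m > 0"
  shows "{d. d dvd p * m} = {d. d dvd m} \<union> (\<lambda>d. p * d) ` {d. d dvd m}"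
    and "\<not> p dvd m \<Longrightarrow> {d. d dvd m} \<inter> (\<lambda>d. p * d) ` {d. d dvd m} = {}"
proof -
  show "{d. d dvd p * m} = {d. d dvd m} \<union> (\<lambda>d. p * d) ` {d. d dvd m}"
  proof safe
    fix d assume d: "d dvd p * m" "d \<notin> (*) p ` {d. d dvd m}"
    obtain a b where ab: "d = a * b" "a dvd p" "b dvd m" using d(1) by (rule dvd_productE)
    have "a = 1 \<or> a = p" using ab(2) p by (auto simp: prime_nat_iff)
    then show "d dvd m" using ab d(2) by auto
  qed auto
qed (auto dest: dvd_mult_left)

lemma sum_divisors_prime_mult:
  fixes f :: "nat \<Rightarrow> 'a::comm_monoid_add"
  assumes p: "prime p" "\<not> p dvd m" and m: "m > 0"
  shows "(\<Sum>d | d dvd p * m. f d) = (\<Sum>d | d dvd m. f d) + (\<Sum>d | d dvd m. f (p * d))"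
proof -
  have "(\<Sum>d | d dvd p * m. f d) = (\<Sum>d | d dvd m. f d) + (\<Sum>d \<in> (\<lambda>d. p * d) ` {d. d dvd m}. f d)"
    unfolding divisors_prime_mult(1)[OF p(1) m]
    using m divisors_prime_mult(2)[OF p(1) m p(2)] by (intro sum.union_disjoint) auto
  also have "(\<Sum>d \<in> (\<lambda>d. p * d) ` {d. d dvd m}. f d) = (\<Sum>d | d dvd m. f (p * d))"
    using p by (subst sum.reindex) (auto simp: inj_on_def)
  finally show ?thesis .
qed

lemma sum_moebius_divisors:
  assumes "n > 0"
  shows "(\<Sum>d | d dvd n. moebius d) = (if n = 1 then 1 else 0)"
  using assms
proof (induction n rule: less_induct)
  case (less n)
  show ?case
  proof (cases "n = 1")
    case True
    then show ?thesis by (simp add: moebius_def)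
  next
    case False
    then obtain p where p: "prime p" "p dvd n" using prime_factor_nat by blast
    then obtain m where n: "n = p * m" by auto
    have m0: "m > 0" using n less.prems by simp
    have mn: "m < n" using n m0 prime_gt_1_nat[OF p(1)] by simp
    show ?thesis
    proof (cases "p dvd m")
      case False
      have "(\<Sum>d | d dvd n. moebius d) = (\<Sum>d | d dvd m. moebius d) + (\<Sum>d | d dvd m. moebius (p * d))"
        unfolding n using sum_divisors_prime_mult[OF p(1) False m0] .
      also have "(\<Sum>d | d dvd m. moebius (p * d)) = (\<Sum>d | d dvd m. - moebius d)"
        using p(1) False by (intro sum.cong) (auto intro!: moebius_prime_mult dest: dvd_trans)
      finally show ?thesis using \<open>n \<noteq> 1\<close> by (simp add: sum_negf)
    next
      case True
      have fin: "finite {d. d dvd n}" using less.prems by simp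
      have "(\<Sum>d | d dvd n. moebius d) = (\<Sum>d | d dvd m. moebius d)"
      proof (rule sum.mono_neutral_right[OF fin])
        show "\<forall>d\<in>{d. d dvd n} - {d. d dvd m}. moebius d = 0"
        proof
          fix d assume d: "d \<in> {d. d dvd n} - {d. d dvd m}"
          then obtain e where e: "d = p * e" "e dvd m"
            using divisors_prime_mult(1)[OF p(1) m0] n by auto
          have "p dvd e"
          proof (rule ccontr)
            assume "\<not> p dvd e"
            then have "p * e dvd m" using True e(2) p(1) by (intro divides_mult) (auto simp: prime_imp_coprime)
            then show False using d e by simp
          qed
          then have "p ^ 2 dvd d" using e by (auto simp: power2_eq_square)
          then show "moebius d = 0" using moebius_square_dvd p(1) by blast
        qed
      qed (auto simp: n)
      also have "\<dots> = 0"
        using less.IH[OF mn m0] True prime_gt_1_nat[OF p(1)] by auto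
      finally show ?thesis using \<open>n \<noteq> 1\<close> by simp
    qed
  qed
qed

text \<open>
  The Dirichlet convolution of \<open>\<phi>\<close> with the Moebius function. At \<open>0\<close> the index set is infinite
  and the value is the meaningless \<open>0\<close>.
\<close>

definition moebius_transform :: "(nat \<Rightarrow> real) \<Rightarrow> nat \<Rightarrow> real" where
  "moebius_transform \<phi> n = (\<Sum>d | d dvd n. of_int (moebius (n div d)) * \<phi> d)"

lemma sum_moebius_transform:
  assumes "n > 0"
  shows "(\<Sum>e | e dvd n. moebius_transform \<phi> e) = \<phi> n"
proof -
  have fin: "finite {d. d dvd m}" if "m dvd n" for m
    using dvd_pos_nat[OF assms that] by simp
  have fin': "finite {c. c dvd n div d}" if "d dvd n" for d
    using fin[of "n div d"] that by (metis dvd_mult_div_cancel dvd_triv_right)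
  have "(\<Sum>e | e dvd n. moebius_transform \<phi> e) =
      (\<Sum>(e, d)\<in>(SIGMA e:{e. e dvd n}. {d. d dvd e}). of_int (moebius (e div d)) * \<phi> d)"
    unfolding moebius_transform_def using fin by (intro sum.Sigma) auto
  also have "\<dots> = (\<Sum>(d, c)\<in>(SIGMA d:{d. d dvd n}. {c. c dvd n div d}). of_int (moebius c) * \<phi> d)"
  proof (rule sum.reindex_bij_witness[where i = "\<lambda>(d, c). (d * c, d)" and j = "\<lambda>(e, d). (d, e div d)"])
    fix x assume "x \<in> (SIGMA e:{e. e dvd n}. {d. d dvd e})"
    then obtain e d where x: "x = (e, d)" "e dvd n" "d dvd e" by auto
    then show "(\<lambda>(d, c). (d * c, d)) ((\<lambda>(e, d). (d, e div d)) x) = x" by simp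
    have "d dvd n" using x dvd_trans by blast
    then show "(\<lambda>(e, d). (d, e div d)) x \<in> (SIGMA d:{d. d dvd n}. {c. c dvd n div d})"
      using x by (simp add: div_dvd_div)
    show "(case (case x of (e, d) \<Rightarrow> (d, e div d)) of (d, c) \<Rightarrow> real_of_int (moebius c) * \<phi> d) =
        (case x of (e, d) \<Rightarrow> real_of_int (moebius (e div d)) * \<phi> d)"
      using x by simp
  next
    fix y assume "y \<in> (SIGMA d:{d. d dvd n}. {c. c dvd n div d})"
    then obtain d c where y: "y = (d, c)" "d dvd n" "c dvd n div d" by auto
    have d0: "d > 0" using y(2) assms by (rule dvd_pos_nat[rotated])
    then show "(\<lambda>(e, d). (d, e div d)) ((\<lambda>(d, c). (d * c, d)) y) = y" using y by simp
    have "d * c dvd d * (n div d)" using y(3) by (rule mult_dvd_mono[OF dvd_refl])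
    then show "(\<lambda>(d, c). (d * c, d)) y \<in> (SIGMA e:{e. e dvd n}. {d. d dvd e})" using y by simp
  qed
  also have "\<dots> = (\<Sum>d | d dvd n. \<Sum>c | c dvd n div d. of_int (moebius c) * \<phi> d)"
    using fin fin' by (intro sum.Sigma[symmetric]) auto
  also have "\<dots> = (\<Sum>d | d dvd n. of_int (\<Sum>c | c dvd n div d. moebius c) * \<phi> d)"
    by (simp add: sum_distrib_right)
  also have "\<dots> = (\<Sum>d | d dvd n. if d = n then \<phi> d else 0)"
  proof (intro sum.cong refl)
    fix d assume "d \<in> {d. d dvd n}"
    then obtain k where k: "n = d * k" by auto
    then have "d > 0" "k > 0" using assms by auto
    then have "(\<Sum>c | c dvd n div d. moebius c) = (if k = 1 then 1 else 0)"
      using sum_moebius_divisors[of k] k by simp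
    moreover have "k = 1 \<longleftrightarrow> d = n" using k \<open>d > 0\<close> by auto
    ultimately show "of_int (\<Sum>c | c dvd n div d. moebius c) * \<phi> d = (if d = n then \<phi> d else 0)" by simp
  qed
  also have "\<dots> = \<phi> n" using assms by simp
  finally show ?thesis .
qed

text \<open>
  By induction on \<open>m\<close>: inversion at \<open>p m\<close> and at \<open>m\<close> gives
  \<open>\<phi> m = \<phi> (p m) = \<phi> m + (\<Sum>e | e dvd m. moebius_transform \<phi> (p e))\<close>, and only the term
  \<open>e = m\<close> of the last sum is not yet known to vanish.
\<close>

lemma moebius_transform_eq_0:
  assumes inv: "\<And>m. m > 0 \<Longrightarrow> \<not> p dvd m \<Longrightarrow> \<phi> (p * m) = \<phi> m"
    and p: "prime p" and m: "m > 0" "\<not> p dvd m"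
  shows "moebius_transform \<phi> (p * m) = 0"
  using m
proof (induction m rule: less_induct)
  case (less m)
  have "\<phi> m = \<phi> (p * m)" using inv less.prems by simp
  also have "\<dots> = (\<Sum>e | e dvd p * m. moebius_transform \<phi> e)"
    using less.prems prime_gt_0_nat[OF p] by (intro sum_moebius_transform[symmetric]) auto
  also have "\<dots> = \<phi> m + (\<Sum>e | e dvd m. moebius_transform \<phi> (p * e))"
    using sum_divisors_prime_mult[OF p less.prems(2,1), of "moebius_transform \<phi>"]
      sum_moebius_transform[OF less.prems(1), of \<phi>] by simp
  also have "(\<Sum>e | e dvd m. moebius_transform \<phi> (p * e)) = (\<Sum>e\<in>{m}. moebius_transform \<phi> (p * e))"
  proof (intro sum.mono_neutral_right ballI)
    fix e assume e: "e \<in> {e. e dvd m} - {m}"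
    have "e \<le> m" using e less.prems by (auto intro: dvd_imp_le)
    moreover have "e \<noteq> m" "e > 0" "\<not> p dvd e" using e less.prems by (auto intro: Nat.gr0I dest: dvd_trans)
    ultimately show "moebius_transform \<phi> (p * e) = 0" by (intro less.IH) auto
  qed (use less.prems in auto)
  finally show ?case by simp
qed

lemma abs_moebius_transform_le:
  assumes "\<And>d. d dvd n \<Longrightarrow> \<bar>\<phi> d\<bar> \<le> B"
  shows "\<bar>moebius_transform \<phi> n\<bar> \<le> real (card {d. d dvd n}) * B"
proof -
  have "\<bar>moebius_transform \<phi> n\<bar> \<le> (\<Sum>d | d dvd n. \<bar>of_int (moebius (n div d)) * \<phi> d\<bar>)"
    unfolding moebius_transform_def by (rule sum_abs)
  also have "\<dots> \<le> (\<Sum>d | d dvd n. B)"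
  proof (rule sum_mono)
    fix d assume d: "d \<in> {d. d dvd n}"
    have "\<bar>real_of_int (moebius (n div d))\<bar> \<le> 1"
      using abs_moebius_le[of "n div d"] by linarith
    then have "\<bar>real_of_int (moebius (n div d))\<bar> * \<bar>\<phi> d\<bar> \<le> 1 * B"
      using assms[of d] d by (intro mult_mono) auto
    then show "\<bar>of_int (moebius (n div d)) * \<phi> d\<bar> \<le> B" by (simp add: abs_mult)
  qed
  finally show ?thesis by simp
qed

section \<open>Squarefull numbers\<close>

text \<open>
  Positive integers in which no prime occurs to exactly the first power.
\<close>

definition squarefull :: "nat \<Rightarrow> bool" where
  "squarefull n \<longleftrightarrow> n > 0 \<and> (\<forall>p. prime p \<longrightarrow> p dvd n \<longrightarrow> p ^ 2 dvd n)"

text \<open>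
  With \<open>n = v s\<^sup>2\<close> and \<open>v\<close> squarefree, a prime divisor of \<open>v\<close> occurs in \<open>n\<close> more than once and therefore
  divides \<open>s\<close>; thus \<open>s = v a\<close> and \<open>n = a\<^sup>2 v\<^sup>3\<close>.
\<close>

lemma squarefull_decompose:
  assumes "squarefull n"
  obtains a b where "a > 0" "b > 0" "n = a ^ 2 * b ^ 3"
proof -
  define v s where "v = squarefree_part n" and "s = square_part n"
  have n0: "n > 0" using assms by (simp add: squarefull_def)
  have n: "n = v * s ^ 2" unfolding v_def s_def by (rule squarefree_decompose)
  have v0: "v > 0" and s0: "s > 0" using n n0 by (auto intro: Nat.gr0I)
  have sfv: "squarefree v" by (simp add: v_def)
  have "v dvd s"
  proof (rule multiplicity_le_imp_dvd)
    fix p :: nat assume p: "prime p"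
    show "multiplicity p v \<le> multiplicity p s"
    proof (cases "p dvd v")
      case True
      have "p ^ 2 dvd n" using True p assms n by (auto simp: squarefull_def)
      moreover have "\<not> p ^ 2 dvd v" using sfv p squarefreeD[of v p] by auto
      ultimately have "p dvd s"
        using n p True
        by (metis coprime_dvd_mult_left_iff coprime_power_right_iff prime_dvd_power prime_imp_coprime coprime_commute
            coprime_power_left_iff)
      then have "multiplicity p s \<ge> 1" using p s0 by (simp add: Suc_le_eq prime_multiplicity_gt_zero_iff)
      moreover have "multiplicity p v \<le> 1" using prime_multiplicity_squarefree_part_le_Suc_0[of p n] p by (simp add: v_def)
      ultimately show ?thesis by simp
    qed (simp add: not_dvd_imp_multiplicity_0)
  qed (use v0 s0 in auto)
  then obtain a where a: "s = v * a" by auto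
  have "n = a ^ 2 * v ^ 3" using n a by (simp add: power2_eq_square power3_eq_cube)
  moreover have "a > 0" using a s0 by (auto intro: Nat.gr0I)
  ultimately show ?thesis using that v0 by blast
qed

lemma not_squarefullE:
  assumes "\<not> squarefull n" "n > 0"
  obtains p m where "prime p" "m > 0" "\<not> p dvd m" "n = p * m"
proof -
  obtain p where p: "prime p" "p dvd n" "\<not> p ^ 2 dvd n" using assms by (auto simp: squarefull_def)
  then obtain m where m: "n = p * m" by auto
  show ?thesis using that[of p m] p m assms(2) by (auto simp: power2_eq_square)
qed

lemma moebius_transform_not_squarefull:
  assumes inv: "\<And>p m. prime p \<Longrightarrow> m > 0 \<Longrightarrow> \<not> p dvd m \<Longrightarrow> \<phi> (p * m) = \<phi> m"
    and "\<not> squarefull n" "n > 0"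
  shows "moebius_transform \<phi> n = 0"
  using not_squarefullE[OF assms(2,3)] moebius_transform_eq_0 inv by metis

text \<open>
  The exponent \<open>1/2\<close> is the borderline: for \<open>e = a\<^sup>2 b\<^sup>3\<close> the sum is at most
  \<open>\<zeta>(1 + 2 \<eta>) \<zeta>(3/2 + 3 \<eta>)\<close>.
\<close>

lemma squarefull_sum_bounded:
  fixes \<eta> :: real
  assumes "\<eta> > 0"
  shows "\<exists>Z>0. \<forall>F. finite F \<longrightarrow> F \<subseteq> Collect squarefull \<longrightarrow> (\<Sum>e\<in>F. real e powr (- (1/2) - \<eta>)) \<le> Z"
proof -
  have s1: "summable (\<lambda>n. real n powr (- 1 - 2 * \<eta>))" using assms by (subst summable_real_powr_iff) auto
  have s2: "summable (\<lambda>n. real n powr (- (3/2) - 3 * \<eta>))" using assms by (subst summable_real_powr_iff) auto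
  define Z1 Z2 where "Z1 = (\<Sum>n. real n powr (- 1 - 2 * \<eta>))" and "Z2 = (\<Sum>n. real n powr (- (3/2) - 3 * \<eta>))"
  have "(\<Sum>e\<in>F. real e powr (- (1/2) - \<eta>)) \<le> Z1 * Z2" if F: "finite F" "F \<subseteq> Collect squarefull" for F
  proof -
    define f where "f e = (SOME ab. fst ab > 0 \<and> snd ab > 0 \<and> e = fst ab ^ 2 * snd ab ^ 3)" for e :: nat
    have f: "fst (f e) > 0" "snd (f e) > 0" "e = fst (f e) ^ 2 * snd (f e) ^ 3" if "e \<in> F" for e
    proof -
      have "\<exists>ab. fst ab > 0 \<and> snd ab > 0 \<and> e = fst ab ^ 2 * snd ab ^ 3"
        using squarefull_decompose[of e] that F by (metis fst_conv mem_Collect_eq snd_conv subsetD)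
      then have "fst (f e) > 0 \<and> snd (f e) > 0 \<and> e = fst (f e) ^ 2 * snd (f e) ^ 3"
        unfolding f_def by (rule someI_ex)
      then show "fst (f e) > 0" "snd (f e) > 0" "e = fst (f e) ^ 2 * snd (f e) ^ 3" by auto
    qed
    have inj: "inj_on f F" using f(3) by (metis inj_onI)
    have "(\<Sum>e\<in>F. real e powr (- (1/2) - \<eta>)) =
        (\<Sum>e\<in>F. (\<lambda>(a, b). real a powr (- 1 - 2 * \<eta>) * real b powr (- (3/2) - 3 * \<eta>)) (f e))"
    proof (intro sum.cong refl)
      fix e assume e: "e \<in> F"
      have eq: "real e = real (fst (f e)) powr 2 * real (snd (f e)) powr 3"
      proof -
        have "real e = real (fst (f e)) ^ 2 * real (snd (f e)) ^ 3"
          using f(3)[OF e] by (metis of_nat_mult of_nat_power)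
        then show ?thesis using f(1,2)[OF e] by (simp add: powr_numeral)
      qed
      have "real e powr (- (1/2) - \<eta>) =
          real (fst (f e)) powr (2 * (- (1/2) - \<eta>)) * real (snd (f e)) powr (3 * (- (1/2) - \<eta>))"
        unfolding eq by (subst powr_mult) (simp_all only: powr_powr powr_ge_zero)
      then show "real e powr (- (1/2) - \<eta>) =
        (\<lambda>(a, b). real a powr (- 1 - 2 * \<eta>) * real b powr (- (3/2) - 3 * \<eta>)) (f e)"
        by (simp add: case_prod_beta algebra_simps)
    qed
    also have "\<dots> = (\<Sum>(a, b)\<in>f ` F. real a powr (- 1 - 2 * \<eta>) * real b powr (- (3/2) - 3 * \<eta>))"
      using inj by (simp add: sum.reindex o_def)
    also have "\<dots> \<le> (\<Sum>(a, b)\<in>fst ` f ` F \<times> snd ` f ` F. real a powr (- 1 - 2 * \<eta>) * real b powr (- (3/2) - 3 * \<eta>))"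
    proof (rule sum_mono2)
      show "f ` F \<subseteq> fst ` f ` F \<times> snd ` f ` F" by (rule subset_fst_snd)
    qed (use F in auto)
    also have "\<dots> = (\<Sum>a\<in>fst ` f ` F. real a powr (- 1 - 2 * \<eta>)) * (\<Sum>b\<in>snd ` f ` F. real b powr (- (3/2) - 3 * \<eta>))"
      by (simp add: sum_product sum.cartesian_product)
    also have "\<dots> \<le> Z1 * Z2"
      unfolding Z1_def Z2_def using F s1 s2
      by (intro mult_mono sum_le_suminf sum_nonneg suminf_nonneg) auto
    finally show ?thesis .
  qed
  then have "\<forall>F. finite F \<longrightarrow> F \<subseteq> Collect squarefull \<longrightarrow>
      (\<Sum>e\<in>F. real e powr (- (1/2) - \<eta>)) \<le> \<bar>Z1 * Z2\<bar> + 1"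
    by (smt (verit))
  moreover have "\<bar>Z1 * Z2\<bar> + 1 > 0" by linarith
  ultimately show ?thesis by blast
qed

lemma squarefull_pos: "squarefull n \<Longrightarrow> n > 0"
  by (simp add: squarefull_def)

lemma powr_mult_sum_bounded:
  assumes Z: "\<And>F. finite F \<Longrightarrow> F \<subseteq> Collect squarefull \<Longrightarrow> (\<Sum>e\<in>F. real e powr t) \<le> Z"
    and F: "finite F" "F \<subseteq> Collect squarefull \<times> Collect squarefull"
  shows "(\<Sum>(e, d)\<in>F. (real e * real d) powr t) \<le> Z * Z"
proof -
  have Z0: "Z \<ge> 0" using Z[of "{}"] by simp
  have "(\<Sum>(e, d)\<in>F. (real e * real d) powr t) \<le> (\<Sum>(e, d)\<in>fst ` F \<times> snd ` F. (real e * real d) powr t)"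
  proof (rule sum_mono2)
    show "F \<subseteq> fst ` F \<times> snd ` F" by (rule subset_fst_snd)
  qed (use F in auto)
  also have "\<dots> = (\<Sum>e\<in>fst ` F. real e powr t) * (\<Sum>d\<in>snd ` F. real d powr t)"
    by (simp add: sum_product sum.cartesian_product powr_mult)
  also have "\<dots> \<le> Z * Z"
    using F Z0 by (intro mult_mono Z sum_nonneg) auto
  finally show ?thesis .
qed

text \<open>
  Here and in the next lemma the cut-off at \<open>D\<close> is replaced by a power of \<open>D / e\<close> (Rankin's trick), so that the
  bound \<open>Z\<close> for the full sum applies.
\<close>

lemma card_squarefull_le:
  assumes Z: "\<And>F. finite F \<Longrightarrow> F \<subseteq> Collect squarefull \<Longrightarrow> (\<Sum>e\<in>F. real e powr (- (1/2) - \<delta>)) \<le> Z"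
    and "\<delta> > 0" "D > 0"
  shows "real (card {e. squarefull e \<and> real e \<le> D}) \<le> Z * D powr (1/2 + \<delta>)"
proof -
  let ?S = "{e. squarefull e \<and> real e \<le> D}"
  have fin: "finite ?S" by (rule finite_subset[of _ "{..nat \<lfloor>D\<rfloor>}"]) (auto simp: le_nat_floor)
  have "real (card ?S) = (\<Sum>e\<in>?S. 1)" by simp
  also have "\<dots> \<le> (\<Sum>e\<in>?S. real e powr (- (1/2) - \<delta>) * D powr (1/2 + \<delta>))"
  proof (rule sum_mono)
    fix e assume e: "e \<in> ?S"
    then have e0: "e > 0" using squarefull_pos by auto
    have "1 = real e powr (- (1/2) - \<delta>) * real e powr (1/2 + \<delta>)" using e0 by (simp flip: powr_add)
    also have "\<dots> \<le> real e powr (- (1/2) - \<delta>) * D powr (1/2 + \<delta>)"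
      using e assms(2) by (intro mult_left_mono powr_mono2) auto
    finally show "1 \<le> real e powr (- (1/2) - \<delta>) * D powr (1/2 + \<delta>)" .
  qed
  also have "\<dots> = (\<Sum>e\<in>?S. real e powr (- (1/2) - \<delta>)) * D powr (1/2 + \<delta>)" by (simp add: sum_distrib_right)
  also have "\<dots> \<le> Z * D powr (1/2 + \<delta>)" using fin by (intro mult_right_mono Z) auto
  finally show ?thesis .
qed

lemma squarefull_tail_le:
  assumes Z: "\<And>F. finite F \<Longrightarrow> F \<subseteq> Collect squarefull \<Longrightarrow> (\<Sum>e\<in>F. real e powr (- (1/2) - \<delta>)) \<le> Z"
    and "\<delta> \<le> 1/2" "D > 0" and F: "finite F" "F \<subseteq> {e. squarefull e \<and> real e > D}"
  shows "(\<Sum>e\<in>F. 1 / real e) \<le> Z * D powr (\<delta> - 1/2)"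
proof -
  have "(\<Sum>e\<in>F. 1 / real e) \<le> (\<Sum>e\<in>F. real e powr (- (1/2) - \<delta>) * D powr (\<delta> - 1/2))"
  proof (rule sum_mono)
    fix e assume e: "e \<in> F"
    then have e0: "e > 0" using squarefull_pos F by auto
    have "1 / real e = real e powr (-1)" using e0 by (simp add: powr_minus divide_inverse)
    also have "\<dots> = real e powr (- (1/2) - \<delta>) * real e powr (\<delta> - 1/2)" by (simp flip: powr_add)
    also have "\<dots> \<le> real e powr (- (1/2) - \<delta>) * D powr (\<delta> - 1/2)"
      using e F assms(2,3) by (intro mult_left_mono powr_mono2') auto
    finally show "1 / real e \<le> real e powr (- (1/2) - \<delta>) * D powr (\<delta> - 1/2)" .
  qed
  also have "\<dots> = (\<Sum>e\<in>F. real e powr (- (1/2) - \<delta>)) * D powr (\<delta> - 1/2)" by (simp add: sum_distrib_right)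
  also have "\<dots> \<le> Z * D powr (\<delta> - 1/2)" using F by (intro mult_right_mono Z) auto
  finally show ?thesis .
qed

section \<open>Counting in residue classes\<close>

lemma card_shifted_multiples:
  assumes "L > 0"
  shows "card {n \<in> {1..N}. L dvd n + s} = (N + s) div L - s div L"
proof (induction N)
  case (Suc N)
  have "{n \<in> {1..Suc N}. L dvd n + s} =
      {n \<in> {1..N}. L dvd n + s} \<union> (if L dvd Suc N + s then {Suc N} else {})"
    by (auto simp: le_Suc_eq)
  moreover have "s div L \<le> (N + s) div L" by (rule div_le_mono) simp
  ultimately show ?case using Suc by (auto simp: div_Suc mod_eq_0_iff_dvd card_insert_if)
qed simp

text \<open>
  The condition says that \<open>n\<close> is congruent to \<open>- s\<close> modulo \<open>L\<close>; every residue class arises in this way.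
\<close>

lemma card_shifted_multiples_approx:
  assumes L: "L > 0"
  shows "\<bar>real (card {n \<in> {1..N}. L dvd n + s}) - real N / real L\<bar> \<le> 1"
proof -
  have fl: "real m / real L - 1 \<le> real (m div L)" "real (m div L) \<le> real m / real L" for m
  proof -
    have "real m = real L * real (m div L) + real (m mod L)"
      by (metis mult_div_mod_eq of_nat_add of_nat_mult)
    moreover have "real (m mod L) < real L" using L by simp
    ultimately show "real m / real L - 1 \<le> real (m div L)" "real (m div L) \<le> real m / real L"
      using L by (simp_all add: field_simps)
  qed
  have "s div L \<le> (N + s) div L" by (rule div_le_mono) simp
  then have "real (card {n \<in> {1..N}. L dvd n + s}) = real ((N + s) div L) - real (s div L)"
    unfolding card_shifted_multiples[OF L] by (rule of_nat_diff)
  moreover have "real (N + s) / real L = real N / real L + real s / real L" by (simp add: add_divide_distrib)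
  ultimately show ?thesis using fl[of "N + s"] fl[of s] by linarith
qed

text \<open>
  The asymptotic density of the integers \<open>n\<close> with \<open>e dvd n\<close> and \<open>d dvd n + k\<close>: such \<open>n\<close> either do not exist or
  form a residue class modulo the least common multiple of \<open>e\<close> and \<open>d\<close>.
\<close>

definition density :: "nat \<Rightarrow> nat \<Rightarrow> nat \<Rightarrow> real" where
  "density k e d = (if \<exists>n. e dvd n \<and> d dvd n + k then 1 / real (lcm e d) else 0)"

lemma density_nonneg: "density k e d \<ge> 0" by (simp add: density_def)

lemma count_approx_density:
  assumes "e > 0" "d > 0"
  shows "\<bar>real (card {n \<in> {1..N}. e dvd n \<and> d dvd n + k}) - real N * density k e d\<bar> \<le> 1"
proof (cases "\<exists>n. e dvd n \<and> d dvd n + k")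
  case True
  then obtain n0 where n0: "e dvd n0" "d dvd n0 + k" by blast
  define L where "L = lcm e d"
  have L: "L > 0" using assms by (simp add: L_def lcm_pos_nat)
  \<comment> \<open>A natural number congruent to \<open>- n0\<close> modulo \<open>L\<close>.\<close>
  define s where "s = n0 * (L - 1)"
  have s: "s + n0 = L * n0" using L by (simp add: s_def algebra_simps)
  have "L dvd n + s \<longleftrightarrow> e dvd n \<and> d dvd n + k" for n
  proof -
    have "e dvd n + s \<longleftrightarrow> e dvd n" using n0 by (simp add: s_def dvd_add_left_iff)
    moreover have "d dvd n + s \<longleftrightarrow> d dvd n + k"
    proof -
      have "d dvd n + s \<longleftrightarrow> d dvd (n + s) + (n0 + k)" using n0 by (simp add: dvd_add_left_iff)
      also have "(n + s) + (n0 + k) = (n + k) + L * n0" using s by simp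
      also have "d dvd (n + k) + L * n0 \<longleftrightarrow> d dvd n + k" 
        by (rule dvd_add_left_iff) (simp add: L_def)
      finally show ?thesis .
    qed
    ultimately show ?thesis by (simp add: L_def)
  qed
  then show ?thesis
    using card_shifted_multiples_approx[OF L, of N s] True by (simp add: density_def L_def)
next
  case False
  then have "{n \<in> {1..N}. e dvd n \<and> d dvd n + k} = {}" by blast
  then show ?thesis using False by (simp only: density_def) simp
qed

text \<open>
  A solution forces \<open>gcd e d\<close> to divide \<open>k\<close>, so the least common multiple is at least \<open>e d / k\<close>.
\<close>

lemma density_le:
  assumes "e > 0" "d > 0" "k > 0"
  shows "density k e d \<le> real k / (real e * real d)"
proof (cases "\<exists>n. e dvd n \<and> d dvd n + k")
  case True
  then obtain n where n: "e dvd n" "d dvd n + k" by blast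
  have "gcd e d dvd k"
    using n by (meson dvd_add_right_iff dvd_trans gcd_dvd1 gcd_dvd2)
  then have "gcd e d \<le> k" using assms by (intro dvd_imp_le)
  have lcm: "real (lcm e d) > 0" using assms by (simp add: lcm_pos_nat)
  have "real e * real d = real (lcm e d) * real (gcd e d)"
    by (metis lcm_gcd_prod mult.commute of_nat_mult prod_gcd_lcm_nat)
  also have "\<dots> \<le> real (lcm e d) * real k" using \<open>gcd e d \<le> k\<close> by (intro mult_left_mono) auto
  finally show ?thesis using True assms lcm by (simp add: density_def field_simps)
next
  case False
  then have "density k e d = 0" by (simp only: density_def if_False)
  then show ?thesis by simp
qed

section \<open>Expansion of the shifted sum\<close>

text \<open>
  The properties of the number of abelian groups on which the asymptotic formula rests. The second one
  says that \<open>a n\<close> depends only on the squarefull part of \<open>n\<close>.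
\<close>

locale squarefull_determined =
  fixes a :: "nat \<Rightarrow> nat"
  assumes pos: "n > 0 \<Longrightarrow> a n > 0"
    and prime_mult: "prime p \<Longrightarrow> m > 0 \<Longrightarrow> \<not> p dvd m \<Longrightarrow> a (p * m) = a m"
    and growth: "\<epsilon> > 0 \<Longrightarrow> \<exists>K>0. \<forall>n>0. real (a n) \<le> K * real n powr \<epsilon>"
begin

text \<open>
  The function \<open>b\<close> with \<open>a n = (\<Sum>d | d dvd n. b d)\<close> for \<open>n > 0\<close>; it is supported on squarefull numbers.
\<close>

definition b :: "nat \<Rightarrow> real" where
  "b = moebius_transform (\<lambda>n. real (a n))"

text \<open>
  The weight with which a triple of \<open>h dvd e\<close> and \<open>d\<close> enters the expansion of \<open>a (n + a n)\<close>.
\<close>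

definition weight :: "nat \<Rightarrow> nat \<Rightarrow> nat \<Rightarrow> real" where
  "weight h e d = of_int (moebius (e div h)) * b d"

text \<open>
  The contribution of the pair \<open>(e, d)\<close> to the mean value of \<open>a (n + a n)\<close>.
\<close>

definition pair_coefficient :: "nat \<Rightarrow> nat \<Rightarrow> real" where
  "pair_coefficient e d = (\<Sum>h | h dvd e. weight h e d * density (a h) e d)"

text \<open>
  The mean value of \<open>a (n + a n)\<close>. An unconditional infinite sum has the value \<open>0\<close> when it does not converge;
  absolute convergence is proved in \<open>pair_coefficient_abs_summable\<close>.
\<close>

definition mean_value :: real where
  "mean_value = (\<Sum>\<^sub>\<infinity>(e, d)\<in>Collect squarefull \<times> Collect squarefull. pair_coefficient e d)"

text \<open>
  Whether \<open>n\<close> is counted by the triple of \<open>h\<close>, \<open>e\<close> and \<open>d\<close>, as a real number; the next definition counts such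
  \<open>n\<close> up to \<open>N\<close>.
\<close>

definition hit_indicator :: "nat \<Rightarrow> nat \<Rightarrow> nat \<Rightarrow> nat \<Rightarrow> real" where
  "hit_indicator h e d n = (if e dvd n \<and> d dvd n + a h then 1 else 0)"

definition hits :: "nat \<Rightarrow> nat \<Rightarrow> nat \<Rightarrow> nat \<Rightarrow> real" where
  "hits h e d N = real (card {n \<in> {1..N}. e dvd n \<and> d dvd n + a h})"

lemma sum_hit_indicator: "(\<Sum>n=1..N. hit_indicator h e d n) = hits h e d N"
proof -
  have "(\<Sum>n=1..N. hit_indicator h e d n) = (\<Sum>n\<in>{n \<in> {1..N}. e dvd n \<and> d dvd n + a h}. 1)"
    unfolding hit_indicator_def by (rule sum.inter_filter[symmetric]) simp
  then show ?thesis by (simp add: hits_def)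
qed

lemma abs_weight_le: "\<bar>weight h e d\<bar> \<le> \<bar>b d\<bar>"
proof -
  have "\<bar>real_of_int (moebius (e div h))\<bar> \<le> 1" using abs_moebius_le[of "e div h"] by linarith
  then have "\<bar>real_of_int (moebius (e div h))\<bar> * \<bar>b d\<bar> \<le> 1 * \<bar>b d\<bar>" by (intro mult_right_mono) auto
  then show ?thesis by (simp add: weight_def abs_mult)
qed

text \<open>
  Moebius inversion with the sum extended from the divisors of \<open>n\<close> to all squarefull numbers up to a bound \<open>M\<close>
  that does not depend on \<open>n\<close>.
\<close>

lemma sum_squarefull_divisors:
  assumes inv: "\<And>p m. prime p \<Longrightarrow> m > 0 \<Longrightarrow> \<not> p dvd m \<Longrightarrow> \<phi> (p * m) = \<phi> m"
    and n: "n > 0" "n \<le> M"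
  shows "\<phi> n = (\<Sum>e | squarefull e \<and> e \<le> M. if e dvd n then moebius_transform \<phi> e else 0)"
proof -
  have "\<phi> n = (\<Sum>e | e dvd n. moebius_transform \<phi> e)" using n by (intro sum_moebius_transform[symmetric])
  also have "\<dots> = (\<Sum>e\<in>{e. squarefull e \<and> e \<le> M} \<inter> {e. e dvd n}. moebius_transform \<phi> e)"
  proof (rule sum.mono_neutral_right)
    show "finite {e. e dvd n}" using n by simp
    show "\<forall>e\<in>{e. e dvd n} - {e. squarefull e \<and> e \<le> M} \<inter> {e. e dvd n}. moebius_transform \<phi> e = 0"
    proof
      fix e assume e: "e \<in> {e. e dvd n} - {e. squarefull e \<and> e \<le> M} \<inter> {e. e dvd n}"
      then have "e \<le> M" "e > 0" using n dvd_imp_le[of e n] by (auto intro: Nat.gr0I)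
      then have "\<not> squarefull e" using e by auto
      then show "moebius_transform \<phi> e = 0" using inv \<open>e > 0\<close> by (intro moebius_transform_not_squarefull)
    qed
  qed auto
  also have "\<dots> = (\<Sum>e | squarefull e \<and> e \<le> M. if e dvd n then moebius_transform \<phi> e else 0)"
    by (subst sum.inter_restrict) auto
  finally show ?thesis .
qed

text \<open>
  Inversion is applied to \<open>\<phi> h = a (n + a h)\<close> with \<open>n\<close> fixed in the first argument, which like \<open>a\<close> ignores primes
  dividing \<open>h\<close> exactly once. Evaluating at \<open>h = n\<close> gives the left-hand side.
\<close>

lemma shifted_value_expansion:
  assumes n: "n > 0" "n \<le> M" and M: "\<And>h. h dvd n \<Longrightarrow> n + a h \<le> M"
  shows "real (a (n + a n)) =
    (\<Sum>e | squarefull e \<and> e \<le> M. \<Sum>d | squarefull d \<and> d \<le> M. \<Sum>h | h dvd e. weight h e d * hit_indicator h e d n)"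
proof -
  define \<phi> where "\<phi> h = real (a (n + a h))" for h
  have "real (a (n + a n)) = \<phi> n" by (simp add: \<phi>_def)
  also have "\<phi> n = (\<Sum>e | squarefull e \<and> e \<le> M. if e dvd n then moebius_transform \<phi> e else 0)"
    using n by (intro sum_squarefull_divisors) (auto simp: \<phi>_def prime_mult)
  also have "\<dots> = (\<Sum>e | squarefull e \<and> e \<le> M. \<Sum>d | squarefull d \<and> d \<le> M. \<Sum>h | h dvd e. weight h e d * hit_indicator h e d n)"
  proof (intro sum.cong refl)
    fix e assume e: "e \<in> {e. squarefull e \<and> e \<le> M}"
    show "(if e dvd n then moebius_transform \<phi> e else 0) =
      (\<Sum>d | squarefull d \<and> d \<le> M. \<Sum>h | h dvd e. weight h e d * hit_indicator h e d n)"
    proof (cases "e dvd n")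
      case True
      have "moebius_transform \<phi> e = (\<Sum>h | h dvd e. of_int (moebius (e div h)) * \<phi> h)"
        by (simp add: moebius_transform_def)
      also have "\<dots> = (\<Sum>h | h dvd e. \<Sum>d | squarefull d \<and> d \<le> M. weight h e d * hit_indicator h e d n)"
      proof (intro sum.cong refl)
        fix h assume h: "h \<in> {h. h dvd e}"
        then have hn: "n + a h \<le> M" using True M dvd_trans by blast
        have "\<phi> h = (\<Sum>d | squarefull d \<and> d \<le> M. if d dvd n + a h then b d else 0)"
          unfolding \<phi>_def b_def using n hn
          by (intro sum_squarefull_divisors[where \<phi> = "\<lambda>n. real (a n)"]) (auto simp: prime_mult)
        then show "of_int (moebius (e div h)) * \<phi> h = (\<Sum>d | squarefull d \<and> d \<le> M. weight h e d * hit_indicator h e d n)"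
          using True by (auto simp: sum_distrib_left weight_def hit_indicator_def intro!: sum.cong)
      qed
      also have "\<dots> = (\<Sum>d | squarefull d \<and> d \<le> M. \<Sum>h | h dvd e. weight h e d * hit_indicator h e d n)"
        by (rule sum.swap)
      finally show ?thesis using True by simp
    qed (simp add: hit_indicator_def)
  qed
  finally show ?thesis .
qed

lemma shifted_sum_expansion:
  assumes M: "\<And>n h. n > 0 \<Longrightarrow> n \<le> N \<Longrightarrow> h dvd n \<Longrightarrow> n + a h \<le> M"
  shows "(\<Sum>n=1..N. real (a (n + a n))) =
    (\<Sum>e | squarefull e \<and> e \<le> M. \<Sum>d | squarefull d \<and> d \<le> M. \<Sum>h | h dvd e. weight h e d * hits h e d N)"
proof -
  have "(\<Sum>n=1..N. real (a (n + a n))) =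
    (\<Sum>n=1..N. \<Sum>e | squarefull e \<and> e \<le> M. \<Sum>d | squarefull d \<and> d \<le> M. \<Sum>h | h dvd e. weight h e d * hit_indicator h e d n)"
  proof (intro sum.cong refl shifted_value_expansion)
    fix n assume "n \<in> {1..N}"
    then have n0: "n > 0" "n \<le> N" by auto
    show "n > 0" by (rule n0)
    show "n \<le> M" using M[OF n0 dvd_refl] by linarith
    show "n + a h \<le> M" if "h dvd n" for h using M[OF n0 that] .
  qed
  also have "\<dots> = (\<Sum>e | squarefull e \<and> e \<le> M. \<Sum>d | squarefull d \<and> d \<le> M. \<Sum>h | h dvd e. \<Sum>n=1..N. weight h e d * hit_indicator h e d n)"
    by (subst sum.swap, rule sum.cong[OF refl], subst sum.swap, rule sum.cong[OF refl], subst sum.swap, rule refl)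
  finally show ?thesis by (simp only: sum_distrib_left[symmetric] sum_hit_indicator)
qed

section \<open>The mean value\<close>

lemma common_bound:
  assumes "\<delta> > 0"
  obtains K where "K \<ge> 1" "\<And>n. n > 0 \<Longrightarrow> real (a n) \<le> K * real n powr \<delta>"
    "\<And>n. n > 0 \<Longrightarrow> real (card {d. d dvd n}) \<le> K * real n powr \<delta>"
    "\<And>n. n > 0 \<Longrightarrow> \<bar>b n\<bar> \<le> K * real n powr \<delta>"
proof -
  obtain A where A: "A > 0" "\<And>n. n > 0 \<Longrightarrow> real (a n) \<le> A * real n powr (\<delta> / 2)"
    using growth[of "\<delta> / 2"] assms by auto
  obtain T where T: "T > 0" "\<And>n. n > 0 \<Longrightarrow> real (card {d. d dvd n}) \<le> T * real n powr (\<delta> / 2)"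
    using card_divisors_growth[of "\<delta> / 2"] assms by auto
  define K where "K = Max {1, A, T, T * A}"
  have K: "K \<ge> 1" "K \<ge> A" "K \<ge> T" "K \<ge> T * A" by (auto simp: K_def)
  have mono: "c * real n powr (\<delta> / 2) \<le> K * real n powr \<delta>" if "n > 0" "0 \<le> c" "c \<le> K" for c n
    using that assms by (intro mult_mono powr_mono) auto
  show ?thesis
  proof (rule that[OF K(1)])
    fix n :: nat assume n: "n > 0"
    show "real (a n) \<le> K * real n powr \<delta>" using A(2)[OF n] mono[OF n, of A] A(1) K by linarith
    show "real (card {d. d dvd n}) \<le> K * real n powr \<delta>" using T(2)[OF n] mono[OF n, of T] T(1) K by linarith
    have "\<bar>b n\<bar> \<le> real (card {d. d dvd n}) * (A * real n powr (\<delta> / 2))"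
      unfolding b_def
    proof (rule abs_moebius_transform_le)
      fix d assume d: "d dvd n"
      then have dn: "d > 0" "d \<le> n" using n by (auto intro: dvd_imp_le Nat.gr0I)
      have "real (a d) \<le> A * real d powr (\<delta> / 2)" using A(2) dn by blast
      also have "\<dots> \<le> A * real n powr (\<delta> / 2)" using A(1) dn assms by (intro mult_left_mono powr_mono2) auto
      finally show "\<bar>real (a d)\<bar> \<le> A * real n powr (\<delta> / 2)" by simp
    qed
    also have "\<dots> \<le> (T * real n powr (\<delta> / 2)) * (A * real n powr (\<delta> / 2))"
      using T(2)[OF n] A(1) by (intro mult_right_mono) auto
    also have "\<dots> = (T * A) * real n powr \<delta>"
      by (simp add: mult_ac flip: powr_add)
    also have "\<dots> \<le> K * real n powr \<delta>" using K by (intro mult_right_mono) auto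
    finally show "\<bar>b n\<bar> \<le> K * real n powr \<delta>" .
  qed
qed

lemma abs_pair_coefficient_le:
  assumes \<delta>: "\<delta> > 0" and K: "K \<ge> 1" and Ka: "\<And>n. n > 0 \<Longrightarrow> real (a n) \<le> K * real n powr \<delta>"
    and Kd: "\<And>n. n > 0 \<Longrightarrow> real (card {d. d dvd n}) \<le> K * real n powr \<delta>"
    and Kb: "\<And>n. n > 0 \<Longrightarrow> \<bar>b n\<bar> \<le> K * real n powr \<delta>"
    and ed: "e > 0" "d > 0"
  shows "\<bar>pair_coefficient e d\<bar> \<le> K ^ 3 * (real e * real d) powr (2 * \<delta> - 1)"
proof -
  let ?B = "(K * real d powr \<delta>) * (K * real e powr \<delta> / (real e * real d))"
  have "\<bar>pair_coefficient e d\<bar> \<le> (\<Sum>h | h dvd e. \<bar>weight h e d * density (a h) e d\<bar>)"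
    unfolding pair_coefficient_def by (rule sum_abs)
  also have "\<dots> \<le> (\<Sum>h | h dvd e. ?B)"
  proof (rule sum_mono)
    fix h assume "h \<in> {h. h dvd e}"
    then have h: "h > 0" "h \<le> e" using ed by (auto intro: dvd_imp_le Nat.gr0I)
    have "density (a h) e d \<le> real (a h) / (real e * real d)" using density_le[OF ed] pos h by blast
    also have "\<dots> \<le> K * real e powr \<delta> / (real e * real d)"
    proof (rule divide_right_mono)
      have "real (a h) \<le> K * real h powr \<delta>" using Ka h by blast
      also have "\<dots> \<le> K * real e powr \<delta>" using h K \<delta> by (intro mult_left_mono powr_mono2) auto
      finally show "real (a h) \<le> K * real e powr \<delta>" .
    qed simp
    finally have 1: "density (a h) e d \<le> K * real e powr \<delta> / (real e * real d)" .
    have "\<bar>weight h e d\<bar> \<le> K * real d powr \<delta>" using abs_weight_le Kb[OF ed(2)] by (rule order_trans)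
    then have "\<bar>weight h e d\<bar> * density (a h) e d \<le> ?B"
      using 1 density_nonneg K by (intro mult_mono) auto
    then show "\<bar>weight h e d * density (a h) e d\<bar> \<le> ?B" using density_nonneg by (simp add: abs_mult)
  qed
  also have "\<dots> = real (card {h. h dvd e}) * ?B" by simp
  also have "\<dots> \<le> (K * real e powr \<delta>) * ?B"
    using Kd[OF ed(1)] K by (intro mult_right_mono) auto
  also have "\<dots> = K ^ 3 * (real e powr (2 * \<delta>) * real d powr \<delta> / (real e * real d))"
  proof -
    have "real e powr (2 * \<delta>) = real e powr \<delta> * real e powr \<delta>" by (simp flip: powr_add)
    then show ?thesis by (simp add: power3_eq_cube mult_ac)
  qed
  also have "\<dots> \<le> K ^ 3 * (real e powr (2 * \<delta>) * real d powr (2 * \<delta>) / (real e * real d))"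
    using ed K \<delta> by (intro mult_left_mono divide_right_mono powr_mono) auto
  also have "real e powr (2 * \<delta>) * real d powr (2 * \<delta>) / (real e * real d) = (real e * real d) powr (2 * \<delta> - 1)"
    using ed by (simp add: powr_diff powr_mult)
  finally show ?thesis .
qed

text \<open>
  Rankin's trick for pairs. The set \<open>F\<close> will consist of pairs with \<open>e > D\<close> or \<open>d > D\<close>; for \<open>D = 1\<close> there is
  no restriction and the bound shows absolute convergence.
\<close>

lemma pair_coefficient_tail_sum_le:
  assumes \<delta>: "\<delta> > 0" "\<delta> \<le> 1/6" and K: "K \<ge> 1" and Ka: "\<And>n. n > 0 \<Longrightarrow> real (a n) \<le> K * real n powr \<delta>"
    and Kd: "\<And>n. n > 0 \<Longrightarrow> real (card {d. d dvd n}) \<le> K * real n powr \<delta>"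
    and Kb: "\<And>n. n > 0 \<Longrightarrow> \<bar>b n\<bar> \<le> K * real n powr \<delta>"
    and Z: "\<And>F. finite F \<Longrightarrow> F \<subseteq> Collect squarefull \<Longrightarrow> (\<Sum>e\<in>F. real e powr (- (1/2) - \<delta>)) \<le> Z"
    and D: "D > 0" and F: "finite F" "F \<subseteq> Collect squarefull \<times> Collect squarefull"
    and FD: "\<And>e d. (e, d) \<in> F \<Longrightarrow> D \<le> real e * real d"
  shows "(\<Sum>(e, d)\<in>F. \<bar>pair_coefficient e d\<bar>) \<le> K ^ 3 * Z ^ 2 * D powr (3 * \<delta> - 1/2)"
proof -
  have "(\<Sum>(e, d)\<in>F. \<bar>pair_coefficient e d\<bar>) \<le>
      (\<Sum>(e, d)\<in>F. K ^ 3 * D powr (3 * \<delta> - 1/2) * (real e * real d) powr (- (1/2) - \<delta>))"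
  proof (rule sum_mono, clarify)
    fix e d assume ed: "(e, d) \<in> F"
    then have e0: "e > 0" "d > 0" using F squarefull_pos by auto
    have "\<bar>pair_coefficient e d\<bar> \<le> K ^ 3 * (real e * real d) powr (2 * \<delta> - 1)"
      using \<delta> by (intro abs_pair_coefficient_le K Ka Kd Kb e0) auto
    also have "(real e * real d) powr (2 * \<delta> - 1) =
        (real e * real d) powr (3 * \<delta> - 1/2) * (real e * real d) powr (- (1/2) - \<delta>)"
      by (simp flip: powr_add)
    also have "K ^ 3 * \<dots> \<le> K ^ 3 * (D powr (3 * \<delta> - 1/2) * (real e * real d) powr (- (1/2) - \<delta>))"
      using FD[OF ed] D \<delta> K by (intro mult_left_mono mult_right_mono powr_mono2') auto
    finally show "\<bar>pair_coefficient e d\<bar> \<le> K ^ 3 * D powr (3 * \<delta> - 1/2) * (real e * real d) powr (- (1/2) - \<delta>)"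
      by (simp add: mult.assoc)
  qed
  also have "\<dots> = K ^ 3 * D powr (3 * \<delta> - 1/2) * (\<Sum>(e, d)\<in>F. (real e * real d) powr (- (1/2) - \<delta>))"
    by (simp add: sum_distrib_left case_prod_beta)
  also have "\<dots> \<le> K ^ 3 * D powr (3 * \<delta> - 1/2) * (Z * Z)"
    using K by (intro mult_left_mono powr_mult_sum_bounded Z F) auto
  finally show ?thesis by (simp add: power2_eq_square mult_ac)
qed

lemma pair_coefficient_abs_summable: "(\<lambda>(e, d). pair_coefficient e d) abs_summable_on Collect squarefull \<times> Collect squarefull"
proof -
  obtain K where K: "K \<ge> 1" "\<And>n. n > 0 \<Longrightarrow> real (a n) \<le> K * real n powr (1/6)"
    "\<And>n. n > 0 \<Longrightarrow> real (card {d. d dvd n}) \<le> K * real n powr (1/6)"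
    "\<And>n. n > 0 \<Longrightarrow> \<bar>b n\<bar> \<le> K * real n powr (1/6)"
    using common_bound[of "1/6"] by auto
  obtain Z where Z: "\<And>F. finite F \<Longrightarrow> F \<subseteq> Collect squarefull \<Longrightarrow> (\<Sum>e\<in>F. real e powr (- (1/2) - 1/6)) \<le> Z"
    using squarefull_sum_bounded[of "1/6"] by auto
  show ?thesis
  proof (rule nonneg_bdd_above_summable_on)
    show "bdd_above (sum (\<lambda>x. norm (case x of (e, d) \<Rightarrow> pair_coefficient e d)) ` {F. F \<subseteq> Collect squarefull \<times> Collect squarefull \<and> finite F})"
    proof (rule bdd_aboveI2)
      fix F assume F: "F \<in> {F. F \<subseteq> Collect squarefull \<times> Collect squarefull \<and> finite F}"
      have "1 \<le> real e * real d" if "(e, d) \<in> F" for e d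
        using that F squarefull_pos[of e] squarefull_pos[of d] mult_mono[of 1 "real e" 1 "real d"] by auto
      then have "(\<Sum>(e, d)\<in>F. \<bar>pair_coefficient e d\<bar>) \<le> K ^ 3 * Z ^ 2 * 1 powr (3 * (1/6) - 1/2)"
        using F by (intro pair_coefficient_tail_sum_le K Z) auto
      then show "(\<Sum>x\<in>F. norm (case x of (e, d) \<Rightarrow> pair_coefficient e d)) \<le> K ^ 3 * Z ^ 2" by (simp add: case_prod_beta)
    qed
  qed simp
qed

lemma mean_value_tail:
  assumes \<delta>: "\<delta> > 0" "\<delta> \<le> 1/6" and K: "K \<ge> 1" and Ka: "\<And>n. n > 0 \<Longrightarrow> real (a n) \<le> K * real n powr \<delta>"
    and Kd: "\<And>n. n > 0 \<Longrightarrow> real (card {d. d dvd n}) \<le> K * real n powr \<delta>"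
    and Kb: "\<And>n. n > 0 \<Longrightarrow> \<bar>b n\<bar> \<le> K * real n powr \<delta>"
    and Z: "\<And>F. finite F \<Longrightarrow> F \<subseteq> Collect squarefull \<Longrightarrow> (\<Sum>e\<in>F. real e powr (- (1/2) - \<delta>)) \<le> Z"
    and D: "D > 0" and S: "S = {e. squarefull e \<and> real e \<le> D}"
  shows "\<bar>mean_value - (\<Sum>(e, d)\<in>S \<times> S. pair_coefficient e d)\<bar> \<le> K ^ 3 * Z ^ 2 * D powr (3 * \<delta> - 1/2)"
proof -
  let ?Q = "Collect squarefull \<times> Collect squarefull" and ?f = "\<lambda>(e, d). pair_coefficient e d"
  have fin: "finite S" unfolding S by (rule finite_subset[of _ "{..nat \<lfloor>D\<rfloor>}"]) (auto simp: le_nat_floor)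
  have sub: "S \<times> S \<subseteq> ?Q" using S by auto
  have abs': "?f abs_summable_on ?Q - S \<times> S"
    using pair_coefficient_abs_summable by (rule summable_on_subset_banach) auto
  then have sum': "?f summable_on ?Q - S \<times> S" by (rule abs_summable_summable)
  have "mean_value = infsum ?f (S \<times> S \<union> (?Q - S \<times> S))"
    unfolding mean_value_def using sub by (simp add: Un_absorb1)
  also have "\<dots> = infsum ?f (S \<times> S) + infsum ?f (?Q - S \<times> S)"
    using fin sum' by (intro infsum_Un_disjoint) auto
  finally have "\<bar>mean_value - (\<Sum>(e, d)\<in>S \<times> S. pair_coefficient e d)\<bar> = norm (infsum ?f (?Q - S \<times> S))"
    using fin by simp
  also have "\<dots> \<le> infsum (\<lambda>x. norm (?f x)) (?Q - S \<times> S)" using abs' by (rule norm_infsum_bound)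
  also have "\<dots> \<le> K ^ 3 * Z ^ 2 * D powr (3 * \<delta> - 1/2)"
  proof (rule infsum_le_finite_sums[OF abs'])
    fix F assume F: "finite F" "F \<subseteq> ?Q - S \<times> S"
    have FD: "D \<le> real e * real d" if "(e, d) \<in> F" for e d
    proof -
      have sq: "squarefull e" "squarefull d" and large: "D < real e \<or> D < real d" using that F S by auto
      have "1 \<le> real e" "1 \<le> real d" using sq[THEN squarefull_pos] by auto
      then have "real e * 1 \<le> real e * real d" "1 * real d \<le> real e * real d"
        by (intro mult_left_mono mult_right_mono; simp)+
      with large show ?thesis by (elim disjE) linarith+
    qed
    have "(\<Sum>(e, d)\<in>F. \<bar>pair_coefficient e d\<bar>) \<le> K ^ 3 * Z ^ 2 * D powr (3 * \<delta> - 1/2)"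
      by (rule pair_coefficient_tail_sum_le[OF \<delta> K Ka Kd Kb Z D F(1) _ FD]) (use F in auto)
    then show "(\<Sum>x\<in>F. norm (?f x)) \<le> K ^ 3 * Z ^ 2 * D powr (3 * \<delta> - 1/2)" by (simp add: case_prod_beta)
  qed
  finally show ?thesis .
qed

section \<open>The error term\<close>

text \<open>
  For each \<open>n\<close> divisible by \<open>e\<close> the number of pairs of \<open>h dvd e\<close> and \<open>d dvd n + a h\<close> is at most \<open>V\<^sup>2\<close>.
\<close>

lemma hits_sum_large_e:
  assumes MN: "\<And>n h. n > 0 \<Longrightarrow> n \<le> N \<Longrightarrow> h dvd n \<Longrightarrow> n + a h \<le> M"
    and V: "V \<ge> 0" "\<And>m. m > 0 \<Longrightarrow> m \<le> M \<Longrightarrow> real (card {d. d dvd m}) \<le> V"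
    and e: "e > 0" "e \<le> M"
  shows "(\<Sum>d | squarefull d \<and> d \<le> M. \<Sum>h | h dvd e. hits h e d N) \<le> V ^ 2 * (real N / real e)"
proof -
  let ?T = "{d. squarefull d \<and> d \<le> M}"
  have "(\<Sum>d\<in>?T. \<Sum>h | h dvd e. hits h e d N) = (\<Sum>d\<in>?T. \<Sum>h | h dvd e. \<Sum>n=1..N. hit_indicator h e d n)"
    by (simp only: sum_hit_indicator)
  also have "\<dots> = (\<Sum>h | h dvd e. \<Sum>n=1..N. \<Sum>d\<in>?T. hit_indicator h e d n)"
    by (subst sum.swap, rule sum.cong[OF refl], rule sum.swap)
  also have "\<dots> \<le> (\<Sum>h | h dvd e. \<Sum>n=1..N. if e dvd n then V else 0)"
  proof (intro sum_mono)
    fix h n assume h: "h \<in> {h. h dvd e}" and n: "n \<in> {1..N}"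
    show "(\<Sum>d\<in>?T. hit_indicator h e d n) \<le> (if e dvd n then V else 0)"
    proof (cases "e dvd n")
      case True
      have "h dvd n" using h True dvd_trans by blast
      then have m: "n + a h > 0" "n + a h \<le> M" using n MN[of n h] by auto
      have "(\<Sum>d\<in>?T. hit_indicator h e d n) = (\<Sum>d\<in>{d \<in> ?T. d dvd n + a h}. 1)"
        unfolding hit_indicator_def using True by (subst sum.inter_filter) (auto intro: sum.cong)
      also have "\<dots> = real (card {d \<in> ?T. d dvd n + a h})" by simp
      also have "\<dots> \<le> real (card {d. d dvd n + a h})"
        using m by (intro of_nat_mono card_mono finite_divisors_nat) auto
      also have "\<dots> \<le> V" by (rule V(2)[OF m])
      finally show ?thesis using True by simp
    qed (simp add: hit_indicator_def)
  qed
  also have "(\<Sum>n=1..N. if e dvd n then V else 0) = V * real (card {n \<in> {1..N}. e dvd n + 0})"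
    by (subst sum.inter_filter[symmetric]) auto
  also have "(\<Sum>h | h dvd e. V * real (card {n \<in> {1..N}. e dvd n + 0})) =
      real (card {h. h dvd e}) * (V * real (card {n \<in> {1..N}. e dvd n + 0}))"
    by simp
  also have "\<dots> \<le> V * (V * (real N / real e))"
  proof (intro mult_mono mult_left_mono)
    show "real (card {h. h dvd e}) \<le> V" by (rule V(2)[OF e])
    show "real (card {n \<in> {1..N}. e dvd n + 0}) \<le> real N / real e"
      unfolding card_shifted_multiples[OF e(1)] by (simp add: of_nat_div_le_of_nat)
  qed (use V in auto)
  finally show ?thesis by (simp add: power2_eq_square mult_ac)
qed

text \<open>
  For fixed \<open>n\<close> there are at most \<open>V\<^sup>2\<close> pairs of \<open>e dvd n\<close> and \<open>h dvd e\<close>. The value \<open>a h\<close> is replaced by a free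
  shift \<open>k \<le> V\<close>, after which \<open>n\<close> runs through residue classes modulo \<open>d\<close>.
\<close>

lemma hits_sum_large_d:
  assumes MN: "\<And>n h. n > 0 \<Longrightarrow> n \<le> N \<Longrightarrow> h dvd n \<Longrightarrow> n + a h \<le> M"
    and V: "V \<ge> 0" "\<And>m. m > 0 \<Longrightarrow> m \<le> M \<Longrightarrow> real (card {d. d dvd m}) \<le> V"
    and Va: "\<And>m. m > 0 \<Longrightarrow> m \<le> M \<Longrightarrow> real (a m) \<le> V"
    and d: "d > 0"
  shows "(\<Sum>e | squarefull e \<and> e \<le> M. \<Sum>h | h dvd e. hits h e d N) \<le> V ^ 2 * (V + 1) * (real N / real d + 1)"
proof -
  let ?T = "{d. squarefull d \<and> d \<le> M}"
  define A where "A = nat \<lfloor>V\<rfloor>"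
  have "(\<Sum>e\<in>?T. \<Sum>h | h dvd e. hits h e d N) = (\<Sum>e\<in>?T. \<Sum>h | h dvd e. \<Sum>n=1..N. hit_indicator h e d n)"
    by (simp only: sum_hit_indicator)
  also have "\<dots> = (\<Sum>n=1..N. \<Sum>e\<in>?T. \<Sum>h | h dvd e. hit_indicator h e d n)"
    by (subst (2) sum.swap, rule sum.cong[OF refl], rule sum.swap)
  also have "\<dots> \<le> (\<Sum>n=1..N. V ^ 2 * (\<Sum>k\<le>A. if d dvd n + k then 1 else 0))"
  proof (rule sum_mono)
    fix n assume n: "n \<in> {1..N}"
    let ?g = "\<Sum>k\<le>A. if d dvd n + k then 1 else 0 :: real"
    have g0: "?g \<ge> 0" by (intro sum_nonneg) auto
    have nM: "n > 0" "n \<le> M" using n MN[of n n] by auto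
    have "(\<Sum>e\<in>?T. \<Sum>h | h dvd e. hit_indicator h e d n) \<le> (\<Sum>e\<in>?T. if e dvd n then V * ?g else 0)"
    proof (rule sum_mono)
      fix e assume e: "e \<in> ?T"
      show "(\<Sum>h | h dvd e. hit_indicator h e d n) \<le> (if e dvd n then V * ?g else 0)"
      proof (cases "e dvd n")
        case True
        have e0: "e > 0" "e \<le> M" using e squarefull_pos by auto
        have "(\<Sum>h | h dvd e. hit_indicator h e d n) \<le> (\<Sum>h | h dvd e. ?g)"
        proof (rule sum_mono)
          fix h assume "h \<in> {h. h dvd e}"
          then have "h > 0" "h \<le> M" using e0 dvd_imp_le[of h e] by (auto intro: Nat.gr0I)
          then have "real (a h) \<le> V" using Va by blast
          then have "a h \<le> A" unfolding A_def by (simp add: le_nat_floor)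
          then have "(if d dvd n + a h then 1 else 0 :: real) \<le> ?g"
            using member_le_sum[of "a h" "{..A}" "\<lambda>k. if d dvd n + k then 1 else 0 :: real"] by auto
          then show "hit_indicator h e d n \<le> ?g" using True by (simp add: hit_indicator_def)
        qed
        also have "\<dots> = real (card {h. h dvd e}) * ?g" by simp
        also have "\<dots> \<le> V * ?g" using V e0 g0 by (intro mult_right_mono) auto
        finally show ?thesis using True by simp
      qed (simp add: hit_indicator_def)
    qed
    also have "\<dots> = (\<Sum>e\<in>{e \<in> ?T. e dvd n}. V * ?g)" by (rule sum.inter_filter[symmetric]) simp
    also have "\<dots> = real (card {e \<in> ?T. e dvd n}) * (V * ?g)" by simp
    also have "\<dots> \<le> V * (V * ?g)"
    proof (rule mult_right_mono)
      have "real (card {e \<in> ?T. e dvd n}) \<le> real (card {e. e dvd n})"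
        using nM by (intro of_nat_mono card_mono finite_divisors_nat) auto
      then show "real (card {e \<in> ?T. e dvd n}) \<le> V" using V(2)[OF nM] by linarith
    qed (use V g0 in auto)
    finally show "(\<Sum>e\<in>?T. \<Sum>h | h dvd e. hit_indicator h e d n) \<le> V ^ 2 * ?g" by (simp add: power2_eq_square mult_ac)
  qed
  also have "\<dots> = V ^ 2 * (\<Sum>k\<le>A. \<Sum>n=1..N. if d dvd n + k then 1 else 0)"
    by (subst sum.swap) (simp add: sum_distrib_left)
  also have "\<dots> \<le> V ^ 2 * (\<Sum>k\<le>A. real N / real d + 1)"
  proof (intro mult_left_mono sum_mono)
    fix k
    have "(\<Sum>n=1..N. if d dvd n + k then 1 else 0) = real (card {n \<in> {1..N}. d dvd n + k})"
      by (subst sum.inter_filter[symmetric]) auto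
    then show "(\<Sum>n=1..N. if d dvd n + k then 1 else 0) \<le> real N / real d + 1"
      using card_shifted_multiples_approx[OF d, of N k] by linarith
  qed simp
  also have "\<dots> = V ^ 2 * ((real A + 1) * (real N / real d + 1))" by simp
  also have "\<dots> \<le> V ^ 2 * ((V + 1) * (real N / real d + 1))"
    using V(1) by (intro mult_left_mono mult_right_mono) (auto simp: A_def)
  finally show ?thesis by (simp add: mult.assoc)
qed

text \<open>
  Pairs \<open>(e, d)\<close> up to the cut-off are replaced by their density, with an error \<open>O(1)\<close> for each triple. All other
  pairs are estimated trivially. The number \<open>V\<close> bounds all the arithmetic functions involved, on the range up to \<open>M\<close>.
\<close>

lemma truncated_expansion_estimate:
  assumes MN: "\<And>n h. n > 0 \<Longrightarrow> n \<le> N \<Longrightarrow> h dvd n \<Longrightarrow> n + a h \<le> M"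
    and V: "V \<ge> 0" "\<And>m. m > 0 \<Longrightarrow> m \<le> M \<Longrightarrow> real (card {d. d dvd m}) \<le> V"
    and Va: "\<And>m. m > 0 \<Longrightarrow> m \<le> M \<Longrightarrow> real (a m) \<le> V"
    and Vb: "\<And>m. m > 0 \<Longrightarrow> m \<le> M \<Longrightarrow> \<bar>b m\<bar> \<le> V"
    and D: "D \<le> real M" and S: "S = {e. squarefull e \<and> real e \<le> D}" and T: "T = {e. squarefull e \<and> e \<le> M}"
  shows "\<bar>(\<Sum>n=1..N. real (a (n + a n))) - real N * (\<Sum>(e, d)\<in>S \<times> S. pair_coefficient e d)\<bar> \<le>
    real (card S) ^ 2 * V ^ 2 + V ^ 3 * (\<Sum>e\<in>T - S. real N / real e)
     + V ^ 3 * (V + 1) * (\<Sum>d\<in>T - S. real N / real d + 1)"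
proof -
  define W where "W e d = (\<Sum>h | h dvd e. weight h e d * hits h e d N)" for e d
  have ST: "S \<subseteq> T" using S T D by auto
  have finT: "finite T" using T by simp
  then have finS: "finite S" using ST finite_subset by blast
  have T0: "e > 0" "e \<le> M" if "e \<in> T" for e using that T squarefull_pos by auto
  have hits0: "hits h e d N \<ge> 0" for h e d by (simp add: hits_def)
  have Wle: "\<bar>W e d\<bar> \<le> V * (\<Sum>h | h dvd e. hits h e d N)" if "d \<in> T" for e d
  proof -
    have "\<bar>W e d\<bar> \<le> (\<Sum>h | h dvd e. \<bar>weight h e d * hits h e d N\<bar>)" unfolding W_def by (rule sum_abs)
    also have "\<dots> \<le> (\<Sum>h | h dvd e. V * hits h e d N)"
      using order_trans[OF abs_weight_le Vb[OF T0[OF that]]] hits0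
      by (intro sum_mono) (auto simp: abs_mult intro: mult_right_mono)
    finally show ?thesis by (simp add: sum_distrib_left)
  qed
  have "(\<Sum>n=1..N. real (a (n + a n))) = (\<Sum>e\<in>T. \<Sum>d\<in>T. W e d)"
    unfolding T W_def using MN by (rule shifted_sum_expansion)
  also have "\<dots> = (\<Sum>(e, d)\<in>T \<times> T. W e d)" by (simp add: sum.cartesian_product)
  also have "\<dots> = (\<Sum>(e, d)\<in>S \<times> S. W e d) + (\<Sum>(e, d)\<in>T \<times> T - S \<times> S. W e d)"
    using finT ST by (subst sum.subset_diff[of "S \<times> S"]) auto
  finally have eq: "(\<Sum>n=1..N. real (a (n + a n))) - real N * (\<Sum>(e, d)\<in>S \<times> S. pair_coefficient e d) =
      (\<Sum>(e, d)\<in>S \<times> S. W e d - real N * pair_coefficient e d) + (\<Sum>(e, d)\<in>T \<times> T - S \<times> S. W e d)"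
    by (simp add: sum_subtractf sum_distrib_left case_prod_beta)
  have "\<bar>\<Sum>(e, d)\<in>S \<times> S. W e d - real N * pair_coefficient e d\<bar> \<le> (\<Sum>(e, d)\<in>S \<times> S. \<bar>W e d - real N * pair_coefficient e d\<bar>)"
    by (simp add: case_prod_beta sum_abs)
  also have "\<dots> \<le> (\<Sum>(e, d)\<in>S \<times> S. V ^ 2)"
  proof (rule sum_mono, clarify)
    fix e d assume "e \<in> S" "d \<in> S"
    then have e: "e > 0" "e \<le> M" and d: "d > 0" "d \<le> M" using ST T0 by auto
    have diff: "W e d - real N * pair_coefficient e d = (\<Sum>h | h dvd e. weight h e d * (hits h e d N - real N * density (a h) e d))"
      by (simp add: W_def pair_coefficient_def sum_distrib_left sum_subtractf[symmetric] algebra_simps)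
    have "\<bar>W e d - real N * pair_coefficient e d\<bar> \<le> (\<Sum>h | h dvd e. \<bar>weight h e d * (hits h e d N - real N * density (a h) e d)\<bar>)"
      unfolding diff by (rule sum_abs)
    also have "\<dots> \<le> (\<Sum>h | h dvd e. V * 1)"
    proof (rule sum_mono)
      fix h
      have w: "\<bar>weight h e d\<bar> \<le> V" using order_trans[OF abs_weight_le Vb[OF d]] .
      have c: "\<bar>hits h e d N - real N * density (a h) e d\<bar> \<le> 1"
        unfolding hits_def by (rule count_approx_density[OF e(1) d(1)])
      show "\<bar>weight h e d * (hits h e d N - real N * density (a h) e d)\<bar> \<le> V * 1"
        unfolding abs_mult by (rule mult_mono[OF w c V(1) abs_ge_zero])
    qed
    also have "\<dots> = real (card {h. h dvd e}) * V" by simp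
    also have "\<dots> \<le> V * V" using V e by (intro mult_right_mono) auto
    finally show "\<bar>W e d - real N * pair_coefficient e d\<bar> \<le> V ^ 2" by (simp add: power2_eq_square)
  qed
  also have "\<dots> = real (card S) ^ 2 * V ^ 2" by (simp add: card_cartesian_product power2_eq_square)
  finally have E1: "\<bar>\<Sum>(e, d)\<in>S \<times> S. W e d - real N * pair_coefficient e d\<bar> \<le> real (card S) ^ 2 * V ^ 2" .
  have "\<bar>\<Sum>(e, d)\<in>T \<times> T - S \<times> S. W e d\<bar> \<le> (\<Sum>(e, d)\<in>T \<times> T - S \<times> S. \<bar>W e d\<bar>)"
    by (simp add: case_prod_beta sum_abs)
  also have "\<dots> \<le> (\<Sum>(e, d)\<in>(T - S) \<times> T \<union> T \<times> (T - S). \<bar>W e d\<bar>)"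
    using finT by (intro sum_mono2) auto
  also have "\<dots> \<le> (\<Sum>(e, d)\<in>(T - S) \<times> T. \<bar>W e d\<bar>) + (\<Sum>(e, d)\<in>T \<times> (T - S). \<bar>W e d\<bar>)"
    using finT sum_nonneg[of "((T - S) \<times> T) \<inter> (T \<times> (T - S))" "\<lambda>(e, d). \<bar>W e d\<bar>"]
    by (subst sum_Un) auto
  also have "(\<Sum>(e, d)\<in>(T - S) \<times> T. \<bar>W e d\<bar>) = (\<Sum>e\<in>T - S. \<Sum>d\<in>T. \<bar>W e d\<bar>)"
    by (simp add: sum.cartesian_product)
  also have "\<dots> \<le> (\<Sum>e\<in>T - S. V * (V ^ 2 * (real N / real e)))"
  proof (rule sum_mono)
    fix e assume e: "e \<in> T - S"
    have "(\<Sum>d\<in>T. \<bar>W e d\<bar>) \<le> (\<Sum>d\<in>T. V * (\<Sum>h | h dvd e. hits h e d N))" by (intro sum_mono Wle)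
    also have "\<dots> = V * (\<Sum>d\<in>T. \<Sum>h | h dvd e. hits h e d N)" by (simp add: sum_distrib_left)
    also have "\<dots> \<le> V * (V ^ 2 * (real N / real e))"
      unfolding T using T0[of e] e by (intro mult_left_mono hits_sum_large_e V MN) auto
    finally show "(\<Sum>d\<in>T. \<bar>W e d\<bar>) \<le> V * (V ^ 2 * (real N / real e))" .
  qed
  also have "(\<Sum>(e, d)\<in>T \<times> (T - S). \<bar>W e d\<bar>) = (\<Sum>d\<in>T - S. \<Sum>e\<in>T. \<bar>W e d\<bar>)"
    by (subst sum.swap) (simp add: sum.cartesian_product)
  also have "\<dots> \<le> (\<Sum>d\<in>T - S. V * (V ^ 2 * (V + 1) * (real N / real d + 1)))"
  proof (rule sum_mono)
    fix d assume d: "d \<in> T - S"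
    have "(\<Sum>e\<in>T. \<bar>W e d\<bar>) \<le> (\<Sum>e\<in>T. V * (\<Sum>h | h dvd e. hits h e d N))" using d by (intro sum_mono Wle) auto
    also have "\<dots> = V * (\<Sum>e\<in>T. \<Sum>h | h dvd e. hits h e d N)" by (simp add: sum_distrib_left)
    also have "\<dots> \<le> V * (V ^ 2 * (V + 1) * (real N / real d + 1))"
      unfolding T using T0[of d] d by (intro mult_left_mono hits_sum_large_d V Va MN) auto
    finally show "(\<Sum>e\<in>T. \<bar>W e d\<bar>) \<le> V * (V ^ 2 * (V + 1) * (real N / real d + 1))" .
  qed
  finally have "\<bar>\<Sum>(e, d)\<in>T \<times> T - S \<times> S. W e d\<bar> \<le>
      (\<Sum>e\<in>T - S. V * (V ^ 2 * (real N / real e))) + (\<Sum>d\<in>T - S. V * (V ^ 2 * (V + 1) * (real N / real d + 1)))"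
    by simp
  also have "\<dots> = V ^ 3 * (\<Sum>e\<in>T - S. real N / real e) + V ^ 3 * (V + 1) * (\<Sum>d\<in>T - S. real N / real d + 1)"
    by (simp add: sum_distrib_left power3_eq_cube power2_eq_square mult.assoc)
  finally show ?thesis unfolding eq using E1 by linarith
qed

text \<open>
  With \<open>D = sqrt N\<close> the small pairs contribute \<open>N powr (1/2 + 3 \<delta>)\<close> and the large pairs, as well as the tail of the
  mean value, at most \<open>N powr (3/4 + 5 \<delta>)\<close>.
\<close>

lemma shifted_sum_estimate:
  assumes \<delta>: "\<delta> > 0" "\<delta> \<le> 1/6"
  shows "\<exists>c. \<forall>N\<ge>1. \<bar>(\<Sum>n=1..N. real (a (n + a n))) - real N * mean_value\<bar> \<le> c * real N powr (3/4 + 5 * \<delta>)"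
proof -
  obtain K where K: "K \<ge> 1" and Ka: "\<And>n. n > 0 \<Longrightarrow> real (a n) \<le> K * real n powr \<delta>"
    and Kd: "\<And>n. n > 0 \<Longrightarrow> real (card {d. d dvd n}) \<le> K * real n powr \<delta>"
    and Kb: "\<And>n. n > 0 \<Longrightarrow> \<bar>b n\<bar> \<le> K * real n powr \<delta>"
    using common_bound[OF \<delta>(1)] by blast
  obtain Z where Z0: "Z > 0" and Z: "\<And>F. finite F \<Longrightarrow> F \<subseteq> Collect squarefull \<Longrightarrow> (\<Sum>e\<in>F. real e powr (- (1/2) - \<delta>)) \<le> Z"
    using squarefull_sum_bounded[OF \<delta>(1)] by blast
  \<comment> \<open>Since \<open>a h \<le> K N\<close> for \<open>h \<le> N\<close>, all numbers \<open>n + a h\<close> are at most \<open>L N\<close>.\<close>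
  define L where "L = nat \<lceil>K\<rceil> + 1"
  have L: "real L \<ge> K + 1" unfolding L_def using K by linarith
  define c1 where "c1 = K * real L powr \<delta>"
  have c1: "c1 \<ge> 1"
  proof -
    have "1 * 1 \<le> K * real L powr \<delta>" using K L \<delta> by (intro mult_mono ge_one_powr_ge_zero) auto
    then show ?thesis by (simp add: c1_def)
  qed
  define C where "C = Z ^ 2 * c1 ^ 2 + c1 ^ 3 * Z + 2 * c1 ^ 4 * (1 + real L) * Z + K ^ 3 * Z ^ 2"
  have "\<bar>(\<Sum>n=1..N. real (a (n + a n))) - real N * mean_value\<bar> \<le> C * real N powr (3/4 + 5 * \<delta>)"
    if N: "N \<ge> 1" for N
  proof -
    define M where "M = L * N"
    define V where "V = c1 * real N powr \<delta>"
    define D where "D = real N powr (1/2)"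
    define S where "S = {e. squarefull e \<and> real e \<le> D}"
    define T where "T = {e. squarefull e \<and> e \<le> M}"
    define X where "X = real N powr (3/4 + 5 * \<delta>)"
    have Np: "real N powr s \<le> real N powr t" if "s \<le> t" for s t using N that by (intro powr_mono) auto
    have V1: "V \<ge> 1"
    proof -
      have "1 * 1 \<le> c1 * real N powr \<delta>" using c1 N \<delta> by (intro mult_mono ge_one_powr_ge_zero) auto
      then show ?thesis by (simp add: V_def)
    qed
    have VM: "K * real m powr \<delta> \<le> V" if "m \<le> M" for m
    proof -
      have "K * real m powr \<delta> \<le> K * real M powr \<delta>" using that K \<delta> by (intro mult_left_mono powr_mono2) auto
      also have "\<dots> = V" by (simp add: V_def c1_def M_def powr_mult)
      finally show ?thesis .
    qed
    have MN: "n + a h \<le> M" if n: "n > 0" "n \<le> N" and h: "h dvd n" for n h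
    proof -
      have h': "h > 0" "h \<le> N" using h n dvd_imp_le[of h n] by (auto intro: Nat.gr0I)
      have "real (a h) \<le> K * real h powr \<delta>" using Ka h'(1) by blast
      also have "\<dots> \<le> K * real N powr 1"
        using h' K \<delta> N order_trans[OF powr_mono2[of \<delta> "real h" "real N"] Np[of \<delta> 1]]
        by (intro mult_left_mono) auto
      finally have "real (n + a h) \<le> (K + 1) * real N" using n by (simp add: algebra_simps)
      also have "\<dots> \<le> real M" using L by (simp add: M_def mult_right_mono)
      finally show ?thesis by linarith
    qed
    have Vd: "real (card {d. d dvd m}) \<le> V" and Va: "real (a m) \<le> V" and Vb: "\<bar>b m\<bar> \<le> V"
      if "m > 0" "m \<le> M" for m
      using Kd[OF that(1)] Ka[OF that(1)] Kb[OF that(1)] VM[OF that(2)] by linarith+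
    have D0: "D > 0" using N by (simp add: D_def)
    have DM: "D \<le> real M"
    proof -
      have "D \<le> real N powr 1" unfolding D_def by (rule Np) simp
      also have "\<dots> = 1 * real N" by simp
      also have "\<dots> \<le> real L * real N" using L K by (intro mult_right_mono) auto
      finally show ?thesis by (simp add: M_def)
    qed
    have Dp: "D powr s = real N powr (s / 2)" for s by (simp add: D_def powr_powr)
    define \<Theta> where "\<Theta> = (\<Sum>e\<in>T - S. 1 / real e)"
    have finT: "finite T" by (simp add: T_def)
    have \<Theta>: "\<Theta> \<le> Z * D powr (\<delta> - 1/2)"
      unfolding \<Theta>_def using \<delta> D0 finT by (intro squarefull_tail_le Z) (auto simp: T_def S_def)
    have N\<Theta>: "real N * \<Theta> \<le> Z * real N powr (3/4 + \<delta> / 2)"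
    proof -
      have "real N * \<Theta> \<le> real N powr 1 * (Z * real N powr ((\<delta> - 1/2) / 2))"
        using \<Theta> N by (auto simp: Dp intro!: mult_left_mono)
      also have "\<dots> = Z * (real N powr 1 * real N powr ((\<delta> - 1/2) / 2))" by simp
      also have "real N powr 1 * real N powr ((\<delta> - 1/2) / 2) = real N powr (3/4 + \<delta> / 2)"
        unfolding powr_add[symmetric] by (simp add: field_simps)
      finally show ?thesis .
    qed
    have Vpow: "V ^ k = c1 ^ k * real N powr (real k * \<delta>)" for k
      using N by (simp add: V_def power_mult_distrib powr_power mult.commute)
    have E1: "real (card S) ^ 2 * V ^ 2 \<le> Z ^ 2 * c1 ^ 2 * X"
    proof -
      have "real (card S) \<le> Z * real N powr (1/4 + \<delta> / 2)"
        using card_squarefull_le[OF Z \<delta>(1) D0] by (simp add: S_def Dp add_divide_distrib)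
      then have "real (card S) ^ 2 \<le> (Z * real N powr (1/4 + \<delta> / 2)) ^ 2" by (intro power_mono) auto
      also have "\<dots> = Z ^ 2 * real N powr (1/2 + \<delta>)"
        using N by (simp add: power_mult_distrib powr_power algebra_simps)
      finally have "real (card S) ^ 2 * V ^ 2 \<le> (Z ^ 2 * real N powr (1/2 + \<delta>)) * (c1 ^ 2 * real N powr (2 * \<delta>))"
        unfolding Vpow of_nat_numeral by (intro mult_right_mono) auto
      also have "\<dots> = Z ^ 2 * c1 ^ 2 * (real N powr (1/2 + \<delta>) * real N powr (2 * \<delta>))" by simp
      also have "real N powr (1/2 + \<delta>) * real N powr (2 * \<delta>) \<le> X"
        unfolding X_def powr_add[symmetric] using \<delta> by (intro Np) auto
      finally show ?thesis using c1 Z0 by (simp add: mult_left_mono)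
    qed
    have E2: "V ^ 3 * (\<Sum>e\<in>T - S. real N / real e) \<le> c1 ^ 3 * Z * X"
    proof -
      have "V ^ 3 * (\<Sum>e\<in>T - S. real N / real e) = V ^ 3 * (real N * \<Theta>)"
        by (simp add: \<Theta>_def sum_distrib_left)
      also have "\<dots> \<le> V ^ 3 * (Z * real N powr (3/4 + \<delta> / 2))" using N\<Theta> V1 by (intro mult_left_mono) auto
      also have "\<dots> = c1 ^ 3 * Z * (real N powr (3 * \<delta>) * real N powr (3/4 + \<delta> / 2))" by (simp add: Vpow)
      also have "\<dots> \<le> c1 ^ 3 * Z * X"
        unfolding X_def powr_add[symmetric] using \<delta> c1 Z0 by (intro mult_left_mono Np) auto
      finally show ?thesis .
    qed
    have E3: "V ^ 3 * (V + 1) * (\<Sum>d\<in>T - S. real N / real d + 1) \<le> 2 * c1 ^ 4 * (1 + real L) * Z * X"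
    proof -
      have "(\<Sum>d\<in>T - S. real N / real d + 1) \<le> (\<Sum>d\<in>T - S. (1 + real L) * real N * (1 / real d))"
      proof (rule sum_mono)
        fix d assume "d \<in> T - S"
        then have "d > 0" "real d \<le> real L * real N"
          using squarefull_pos by (auto simp: T_def M_def simp flip: of_nat_mult)
        then show "real N / real d + 1 \<le> (1 + real L) * real N * (1 / real d)" by (simp add: field_simps)
      qed
      also have "\<dots> = (1 + real L) * (real N * \<Theta>)" by (simp add: \<Theta>_def sum_distrib_left mult.assoc)
      also have "\<dots> \<le> (1 + real L) * (Z * real N powr (3/4 + \<delta> / 2))" using N\<Theta> by (intro mult_left_mono) auto
      finally have 1: "(\<Sum>d\<in>T - S. real N / real d + 1) \<le> (1 + real L) * (Z * real N powr (3/4 + \<delta> / 2))" .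
      have "V ^ 3 * (V + 1) * (\<Sum>d\<in>T - S. real N / real d + 1) \<le>
          V ^ 3 * (2 * V) * ((1 + real L) * (Z * real N powr (3/4 + \<delta> / 2)))"
        using 1 V1 by (intro mult_mono) (auto intro!: sum_nonneg mult_nonneg_nonneg)
      also have "V ^ 3 * (2 * V) = 2 * V ^ 4" by (simp add: power3_eq_cube power4_eq_xxxx)
      also have "2 * V ^ 4 * ((1 + real L) * (Z * real N powr (3/4 + \<delta> / 2))) =
          2 * c1 ^ 4 * (1 + real L) * Z * (real N powr (4 * \<delta>) * real N powr (3/4 + \<delta> / 2))" by (simp add: Vpow)
      also have "\<dots> \<le> 2 * c1 ^ 4 * (1 + real L) * Z * X"
        unfolding X_def powr_add[symmetric] using \<delta> c1 Z0 by (intro mult_left_mono Np) auto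
      finally show ?thesis .
    qed
    have E4: "real N * \<bar>mean_value - (\<Sum>(e, d)\<in>S \<times> S. pair_coefficient e d)\<bar> \<le> K ^ 3 * Z ^ 2 * X"
    proof -
      have "real N * \<bar>mean_value - (\<Sum>(e, d)\<in>S \<times> S. pair_coefficient e d)\<bar> \<le> real N * (K ^ 3 * Z ^ 2 * D powr (3 * \<delta> - 1/2))"
        by (intro mult_left_mono mean_value_tail \<delta> K Ka Kd Kb Z D0 S_def) auto
      also have "\<dots> = K ^ 3 * Z ^ 2 * (real N powr 1 * real N powr ((3 * \<delta> - 1/2) / 2))" using N by (simp add: Dp)
      also have "\<dots> \<le> K ^ 3 * Z ^ 2 * X"
        unfolding X_def powr_add[symmetric] using \<delta> K Z0 by (intro mult_left_mono Np) (auto simp: field_simps)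
      finally show ?thesis .
    qed
    have "\<bar>(\<Sum>n=1..N. real (a (n + a n))) - real N * (\<Sum>(e, d)\<in>S \<times> S. pair_coefficient e d)\<bar> \<le>
      real (card S) ^ 2 * V ^ 2 + V ^ 3 * (\<Sum>e\<in>T - S. real N / real e)
       + V ^ 3 * (V + 1) * (\<Sum>d\<in>T - S. real N / real d + 1)"
      by (rule truncated_expansion_estimate[OF MN _ Vd Va Vb DM S_def T_def]) (use V1 in auto)
    moreover have "\<bar>real N * (\<Sum>(e, d)\<in>S \<times> S. pair_coefficient e d) - real N * mean_value\<bar> =
        real N * \<bar>mean_value - (\<Sum>(e, d)\<in>S \<times> S. pair_coefficient e d)\<bar>"
      by (simp add: abs_mult abs_minus_commute flip: right_diff_distrib)
    moreover have "C * X = Z ^ 2 * c1 ^ 2 * X + c1 ^ 3 * Z * X + 2 * c1 ^ 4 * (1 + real L) * Z * X + K ^ 3 * Z ^ 2 * X"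
      by (simp add: C_def algebra_simps)
    ultimately show ?thesis using E1 E2 E3 E4 unfolding X_def by linarith
  qed
  then show ?thesis by blast
qed

text \<open>
  As \<open>a \<ge> 1\<close>, the sum up to \<open>N\<close> is at least \<open>N\<close>, and the estimate gives \<open>mean_value \<ge> 1\<close>.
\<close>

lemma mean_value_pos: "mean_value > 0"
proof -
  obtain c where c: "\<And>N. N \<ge> 1 \<Longrightarrow> \<bar>(\<Sum>n=1..N. real (a (n + a n))) - real N * mean_value\<bar> \<le> c * real N powr (3/4 + 5 * (1/25))"
    using shifted_sum_estimate[of "1/25"] by auto
  have "1 - mean_value \<le> c * real N powr (- (1/20))" if N: "N \<ge> 1" for N
  proof -
    have "(\<Sum>n=1..N. 1) \<le> (\<Sum>n=1..N. real (a (n + a n)))"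
    proof (rule sum_mono)
      fix n assume "n \<in> {1..N}"
      then have "a (n + a n) > 0" by (intro pos) auto
      then show "1 \<le> real (a (n + a n))" by simp
    qed
    then have "real N * (1 - mean_value) \<le> c * real N powr (3/4 + 5 * (1/25))"
      using c[OF N] by (simp add: algebra_simps)
    also have "\<dots> = real N * (c * real N powr (- (1/20)))"
      using N powr_add[of "real N" 1 "- (1/20)"] by simp
    finally show ?thesis using N by simp
  qed
  moreover have "(\<lambda>N. c * real N powr (- (1/20))) \<longlonglongrightarrow> c * 0"
    by (intro tendsto_mult tendsto_const tendsto_neg_powr filterlim_real_sequentially) auto
  ultimately have "1 - mean_value \<le> 0"
    by (intro tendsto_lowerbound[where F = sequentially and f = "\<lambda>N. c * real N powr (- (1/20))"])
       (auto simp: eventually_at_top_linorder)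
  then show ?thesis by simp
qed

theorem shifted_sum_asymptotics:
  assumes "\<epsilon> > 0"
  shows "(\<lambda>x::real. (\<Sum>n | 1 \<le> n \<and> real n \<le> x. real (a (n + a n))) - mean_value * x)
    \<in> O[at_top](\<lambda>x. x powr (3/4 + \<epsilon>))"
proof -
  define \<delta> where "\<delta> = min (\<epsilon> / 5) (1/6)"
  have \<delta>: "\<delta> > 0" "\<delta> \<le> 1/6" "5 * \<delta> \<le> \<epsilon>" using assms by (auto simp: \<delta>_def)
  obtain c where c: "\<And>N. N \<ge> 1 \<Longrightarrow> \<bar>(\<Sum>n=1..N. real (a (n + a n))) - real N * mean_value\<bar> \<le> c * real N powr (3/4 + 5 * \<delta>)"
    using shifted_sum_estimate[OF \<delta>(1,2)] by blast
  show ?thesis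
  proof (rule bigoI[of _ "\<bar>c\<bar> + mean_value"], rule eventually_mono[OF eventually_ge_at_top[of 1]])
    fix x :: real assume x: "x \<ge> 1"
    define N where "N = nat \<lfloor>x\<rfloor>"
    have N: "N \<ge> 1" "real N \<le> x" "x < real N + 1" using x unfolding N_def by linarith+
    have set: "{n. 1 \<le> n \<and> real n \<le> x} = {1..N}"
      using x unfolding N_def by (auto simp: le_nat_floor) linarith
    let ?s = "\<Sum>n=1..N. real (a (n + a n))" and ?X = "x powr (3/4 + \<epsilon>)"
    have X1: "?X \<ge> 1" using x assms by (intro ge_one_powr_ge_zero) auto
    have "\<bar>?s - mean_value * x\<bar> \<le> \<bar>?s - real N * mean_value\<bar> + mean_value * (x - real N)"
    proof -
      have "?s - mean_value * x = (?s - real N * mean_value) - mean_value * (x - real N)" by (simp add: algebra_simps)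
      moreover have "mean_value * (x - real N) \<ge> 0" using mean_value_pos N by simp
      ultimately show ?thesis by linarith
    qed
    also have "\<dots> \<le> \<bar>c\<bar> * ?X + mean_value * ?X"
    proof (rule add_mono)
      have "\<bar>?s - real N * mean_value\<bar> \<le> c * real N powr (3/4 + 5 * \<delta>)" using c N(1) by blast
      also have "\<dots> \<le> \<bar>c\<bar> * real N powr (3/4 + 5 * \<delta>)" by (intro mult_right_mono) auto
      also have "\<dots> \<le> \<bar>c\<bar> * ?X"
      proof (rule mult_left_mono)
        have "real N powr (3/4 + 5 * \<delta>) \<le> x powr (3/4 + 5 * \<delta>)" using N \<delta> by (intro powr_mono2) auto
        also have "\<dots> \<le> ?X" using x \<delta> by (intro powr_mono) auto
        finally show "real N powr (3/4 + 5 * \<delta>) \<le> ?X" .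
      qed simp
      finally show "\<bar>?s - real N * mean_value\<bar> \<le> \<bar>c\<bar> * ?X" .
      show "mean_value * (x - real N) \<le> mean_value * ?X"
        using mean_value_pos N X1 by (intro mult_left_mono) auto
    qed
    finally show "norm ((\<Sum>n | 1 \<le> n \<and> real n \<le> x. real (a (n + a n))) - mean_value * x) \<le> (\<bar>c\<bar> + mean_value) * norm ?X"
      unfolding set by (simp add: algebra_simps)
  qed
qed

end

section \<open>The sum over abelian groups\<close>

theorem theorem1:
  shows "\<exists>C::real. C > 0 \<and>
           (\<forall>\<epsilon>::real. \<epsilon> > 0 \<longrightarrow>
              (\<lambda>x::real. Q x - C * x) \<in> O[at_top](\<lambda>x. x powr (3/4 + \<epsilon>)))"
proof -
  interpret squarefull_determined num_abelian_groups
    by unfold_locales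
      (auto intro: num_abelian_groups_pos num_abelian_groups_prime_mult num_abelian_groups_growth)
  show ?thesis
    unfolding Q_def using mean_value_pos shifted_sum_asymptotics by blast
qed

end
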